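(* Let $F=\sum_{k=1}^Na_kG_k$ with real coefficients $a_1,\dots,a_N$ (not necessarily positive), and let $\mathcal{F}(p_0,\dots,p_3)=\sum_{k=1}^Na_k\mathcal{E}_k(p_0,\dots,p_3)$. For every good block $B$, $$\min_{v\in\langle B\rangle}\mathcal{F}(v)\ge\min_{v\in B}\mathcal{F}(v)-\mathbf{ERR}_F(B),\qquad \mathbf{ERR}_F(B)=\sum_{k=1}^N|a_k|\,\mathbf{ERR}_k(B).$$
   Context: Stereographic projection $\Sigma(x,y,z)=(x/(1-z),y/(1-z))$, $\Sigma(0,0,1)=\infty$; $\widehat p=\Sigma^{-1}(p)$. $G_k(p,q)=(4-\|\widehat p-\widehat q\|^2)^k$. Dyadic segments: segments of the $x$-axis obtained from $[0,4]\times\{0\}$ by repeated bisection. Dyadic squares: obtained from $[-2,2]^2$ by repeated quartering; good if contained in $[-3/2,3/2]^2$ with side length $\le1/2$. $Q$ also denotes its vertex set, $\langle Q\rangle$ its convex hull, $\widehat Q=\Sigma^{-1}(Q)$, $\langle\widehat Q\rangle$ the convex hull of $\widehat Q$ in $\mathbb{R}^3$. $d(Q)$ = diameter of $\langle\widehat Q\rangle$; $d_1(Q)$ = longest edge length of $\langle\widehat Q\rangle$; $D_Q$ = smallest closed disk in $\mathbb{R}^2$ whose boundary contains $Q$, $d_2(Q)$ = Euclidean diameter of $\Sigma^{-1}(D_Q)$. $\chi(D,d)=\frac{d^2}{4D}+\frac{d^4}{2D^3}$; $\delta(Q)=\chi(2,d_2)$ for segments, $\max(\chi(1,d_1),\chi(2,d_2))$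 for good squares; $d(\{\infty\})=\delta(\{\infty\})=0$. $(Q\cdot Q')_{\max}=\max_{i,j}\widehat q_i\cdot\widehat q'_j+\delta(Q)+\delta(Q')+\delta(Q)\delta(Q')$; $(Q\cdot\{\infty\})_{\max}=\max_i\widehat q_i\cdot(0,0,1)$. $T=2+2(Q\cdot Q')_{\max}$; $\epsilon_k(Q,Q')=\frac12k(k-1)T^{k-2}d(Q)^2+2kT^{k-1}\delta(Q)$, $\epsilon_k(\{\infty\},Q')=0$. A good block is $B=(Q_0,\dots,Q_3)$, $Q_0$ a dyadic segment, $Q_1,Q_2,Q_3$ good dyadic squares; $Q_4=\{\infty\}$. $\langle B\rangle=\{(p_0,\dots,p_3):p_i\in\langle Q_i\rangle\}$; $B$ also denotes the vertex configurations ($p_i\in Q_i$). $\mathcal{E}_k(p_0,\dots,p_3)=\sum_{0\le i<j\le4}G_k(p_i,p_j)$ with $p_4=\infty$; $\mathbf{ERR}_k(B)=\sum_{i=0}^3\sum_{j\le4,\,j\ne i}\epsilon_k(Q_i,Q_j)$. *)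

theory Defs
  imports "HOL-Analysis.Analysis"
begin

type_synonym pt2 = "real \<times> real"
type_synonym pt3 = "real \<times> real \<times> real"

definition stereo :: "pt3 \<Rightarrow> pt2" where
  "stereo u = (case u of (x, y, z) \<Rightarrow> (x / (1 - z), y / (1 - z)))"

definition north :: pt3 where "north = (0, 0, 1)"

definition hat :: "pt2 \<Rightarrow> pt3" where
  "hat p = inv_into (sphere 0 1 - {north}) stereo p"

text \<open>Points of the extended plane: None is the point at infinity.\<close>
definition hatx :: "pt2 option \<Rightarrow> pt3" where
  "hatx q = (case q of None \<Rightarrow> north | Some p \<Rightarrow> hat p)"

definition Gk :: "nat \<Rightarrow> pt2 option \<Rightarrow> pt2 option \<Rightarrow> real" where
  "Gk k p q = (4 - (norm (hatx p - hatx q))\<^sup>2) ^ k"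

text \<open>Dyadic cells: Seg n j = [4j/2^n, 4(j+1)/2^n] x {0};
  Sq n i j = [-2+4i/2^n, -2+4(i+1)/2^n] x [-2+4j/2^n, -2+4(j+1)/2^n];
  Infty = the point at infinity.\<close>
datatype cell = Seg nat nat | Sq nat nat nat | Infty

definition dy :: "nat \<Rightarrow> nat \<Rightarrow> real" where
  "dy n i = -2 + 4 * real i / 2 ^ n"

definition sq_corner :: "nat \<Rightarrow> nat \<Rightarrow> nat \<Rightarrow> nat \<Rightarrow> pt2" where
  "sq_corner n i j m =
     (if m mod 4 = 0 then (dy n i, dy n j)
      else if m mod 4 = 1 then (dy n (Suc i), dy n j)
      else if m mod 4 = 2 then (dy n (Suc i), dy n (Suc j))
      else (dy n i, dy n (Suc j)))"

fun verts :: "cell \<Rightarrow> pt2 set" where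
  "verts (Seg n j) = {(4 * real j / 2 ^ n, 0), (4 * real (Suc j) / 2 ^ n, 0)}"
| "verts (Sq n i j) = sq_corner n i j ` {0..<4}"
| "verts Infty = {}"

fun dyadic_cell :: "cell \<Rightarrow> bool" where
  "dyadic_cell (Seg n j) = (j < 2 ^ n)"
| "dyadic_cell (Sq n i j) = (i < 2 ^ n \<and> j < 2 ^ n)"
| "dyadic_cell Infty = False"

definition good_square :: "cell \<Rightarrow> bool" where
  "good_square Q = (\<exists>n i j. Q = Sq n i j \<and> dyadic_cell Q
      \<and> convex hull (verts Q) \<subseteq> {p. \<bar>fst p\<bar> \<le> 3/2 \<and> \<bar>snd p\<bar> \<le> 3/2}
      \<and> 4 / 2 ^ n \<le> (1/2 :: real))"

definition is_dyadic_segment :: "cell \<Rightarrow> bool" where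
  "is_dyadic_segment Q = (\<exists>n j. Q = Seg n j \<and> dyadic_cell Q)"

definition vhat :: "cell \<Rightarrow> pt3 set" where
  "vhat Q = (if Q = Infty then {north} else hat ` verts Q)"

definition dQ :: "cell \<Rightarrow> real" where
  "dQ Q = (if Q = Infty then 0 else diameter (convex hull (vhat Q)))"

text \<open>d1(Q): longest edge of the convex hull of Q-hat (the edges are the
  images of consecutive corners of the square).\<close>
definition d1 :: "cell \<Rightarrow> real" where
  "d1 Q = (case Q of Sq n i j \<Rightarrow>
      Max ((\<lambda>m. dist (hat (sq_corner n i j m)) (hat (sq_corner n i j (Suc m)))) ` {0..<4})
    | _ \<Rightarrow> 0)"

definition disk :: "cell \<Rightarrow> pt2 set" where
  "disk Q = (case ARG_MIN snd cr. snd cr \<ge> 0 \<and> verts Q \<subseteq> sphere (fst cr) (snd cr)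
             of (c, r) \<Rightarrow> cball c r)"

definition d2 :: "cell \<Rightarrow> real" where
  "d2 Q = diameter (hat ` disk Q)"

definition chi :: "real \<Rightarrow> real \<Rightarrow> real" where
  "chi D d = d\<^sup>2 / (4 * D) + d ^ 4 / (2 * D ^ 3)"

fun delta :: "cell \<Rightarrow> real" where
  "delta (Seg n j) = chi 2 (d2 (Seg n j))"
| "delta (Sq n i j) = max (chi 1 (d1 (Sq n i j))) (chi 2 (d2 (Sq n i j)))"
| "delta Infty = 0"

definition dotmax :: "cell \<Rightarrow> cell \<Rightarrow> real" where
  "dotmax Q Q' = (if Q' = Infty then Max {u \<bullet> north | u. u \<in> vhat Q}
     else Max {u \<bullet> v | u v. u \<in> vhat Q \<and> v \<in> vhat Q'}
          + delta Q + delta Q' + delta Q * delta Q')"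

definition eps :: "nat \<Rightarrow> cell \<Rightarrow> cell \<Rightarrow> real" where
  "eps k Q Q' = (if Q = Infty then 0 else
     (let T = 2 + 2 * dotmax Q Q' in
       1/2 * real k * (real k - 1) * T ^ (k - 2) * (dQ Q)\<^sup>2
       + 2 * real k * T ^ (k - 1) * delta Q))"

text \<open>A block is given by Q :: nat => cell, using Q 0 .. Q 3; Q_4 is infinity.\<close>
definition blk :: "(nat \<Rightarrow> cell) \<Rightarrow> nat \<Rightarrow> cell" where
  "blk Q i = (if i < 4 then Q i else Infty)"

definition good_block :: "(nat \<Rightarrow> cell) \<Rightarrow> bool" where
  "good_block Q = (is_dyadic_segment (Q 0) \<and> good_square (Q 1)
                   \<and> good_square (Q 2) \<and> good_square (Q 3))"

definition ERR :: "nat \<Rightarrow> (nat \<Rightarrow> cell) \<Rightarrow> real" where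
  "ERR k Q = (\<Sum>i<4. \<Sum>j\<in>{..4} - {i}. eps k (blk Q i) (blk Q j))"

text \<open>Configurations p_0..p_3 (p i for i<4); p_4 is infinity.\<close>
definition cfg :: "(nat \<Rightarrow> pt2) \<Rightarrow> nat \<Rightarrow> pt2 option" where
  "cfg p i = (if i < 4 then Some (p i) else None)"

definition energy :: "nat \<Rightarrow> (nat \<Rightarrow> pt2) \<Rightarrow> real" where
  "energy k p = (\<Sum>j\<le>4. \<Sum>i<j. Gk k (cfg p i) (cfg p j))"

end

theory Submission
  imports Defs
begin

text \<open>
  Inverse stereographic projection agrees on the vertices of a cell, which lie on a circle, with a
  projective map, so convex combinations of the vertices are carried to convex combinations of their
  images.  The key point is that \<open>hat p\<close>, for \<open>p\<close> in a cell \<open>Q\<close>, is within \<open>delta Q\<close> of the convex hull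
  of \<open>vhat Q\<close>.  If the ray from the origin through \<open>hat p\<close> meets that hull, the distance along the ray
  is at most the height of the spherical cap over the circumscribed disk, hence at most \<open>chi 2 (d2 Q)\<close>.
  Otherwise \<open>hat p\<close> lies on a minor arc over some edge of the hull, on a circle of diameter at least 1,
  and the height of that arc is at most \<open>chi 1 (d1 Q)\<close>.

  Since \<open>Gk k p q\<close> is the \<open>k\<close>-th power of \<open>2 + 2 * (hat p \<bullet> hat q)\<close>, a Taylor estimate then
  bounds by \<open>eps\<close> the error made when one point is replaced by a random vertex of its cell, with the
  same vertex distribution for all \<open>k\<close> and all partners.  Some vertex does at least as well as the
  average, and replacing the four points one after the other gives the theorem.
\<close>

section \<open>Powers of convex combinations\<close>

lemma power_first_order_bound:
  fixes x y T :: real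
  assumes "0 \<le> x" "x \<le> T" "0 \<le> y" "y \<le> T"
  shows "\<bar>x ^ k - y ^ k\<bar> \<le> real k * T ^ (k - 1) * \<bar>x - y\<bar>"
proof (induction k)
  case 0
  then show ?case by simp
next
  case (Suc k)
  have T: "0 \<le> T" using assms by linarith
  have "x ^ Suc k - y ^ Suc k = x * (x ^ k - y ^ k) + y ^ k * (x - y)"
    by (simp add: algebra_simps)
  then have "\<bar>x ^ Suc k - y ^ Suc k\<bar> \<le> x * \<bar>x ^ k - y ^ k\<bar> + y ^ k * \<bar>x - y\<bar>"
    using abs_triangle_ineq[of "x * (x ^ k - y ^ k)" "y ^ k * (x - y)"] assms
    by (simp add: abs_mult)
  also have "x * \<bar>x ^ k - y ^ k\<bar> \<le> T * (real k * T ^ (k - 1) * \<bar>x - y\<bar>)"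
    using Suc assms T by (intro mult_mono) auto
  also have "T * (real k * T ^ (k - 1) * \<bar>x - y\<bar>) = real k * T ^ k * \<bar>x - y\<bar>"
    by (cases k) auto
  also have "y ^ k * \<bar>x - y\<bar> \<le> T ^ k * \<bar>x - y\<bar>"
    using assms by (intro mult_right_mono power_mono) auto
  finally show ?case by (simp add: algebra_simps)
qed

text \<open>Induction works because
  \<open>R (Suc k) = x * R k + k * y ^ (k - 1) * (x - y)^2\<close>, where both terms are
  nonnegative. The exponents \<open>k - 1\<close> and \<open>k - 2\<close> are truncated only where
  the coefficient in front of them vanishes.\<close>

lemma power_taylor_remainder:
  fixes x y T :: real
  assumes "0 \<le> x" "x \<le> T" "0 \<le> y" "y \<le> T"
  defines "R \<equiv> \<lambda>k. x ^ k - y ^ k - real k * y ^ (k - 1) * (x - y)"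
  shows "0 \<le> R k \<and> R k \<le> 1/2 * real k * (real k - 1) * T ^ (k - 2) * (x - y)\<^sup>2"
proof (induction k)
  case 0
  then show ?case by (simp add: R_def)
next
  case (Suc k)
  have T: "0 \<le> T" using assms by linarith
  have rec: "R (Suc k) = x * R k + real k * y ^ (k - 1) * (x - y)\<^sup>2"
    by (cases k) (simp_all add: R_def algebra_simps power2_eq_square)
  have "x * R k \<le> T * (1/2 * real k * (real k - 1) * T ^ (k - 2) * (x - y)\<^sup>2)"
    using Suc assms T by (intro mult_mono) auto
  also have "\<dots> = 1/2 * real k * (real k - 1) * T ^ (k - 1) * (x - y)\<^sup>2"
  proof (cases "k \<le> 1")
    case True
    then have "k = 0 \<or> k = 1" by linarith
    then show ?thesis by auto
  next
    case False
    then obtain j where "k = Suc (Suc j)"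
      by (metis One_nat_def not_less_eq_eq not0_implies_Suc le0 le_SucE)
    then show ?thesis by simp
  qed
  finally have 1: "x * R k \<le> 1/2 * real k * (real k - 1) * T ^ (k - 1) * (x - y)\<^sup>2" .
  have 2: "real k * y ^ (k - 1) * (x - y)\<^sup>2 \<le> real k * T ^ (k - 1) * (x - y)\<^sup>2"
    using assms by (intro mult_right_mono mult_left_mono power_mono) auto
  have "1/2 * real k * (real k - 1) * T ^ (k - 1) * (x - y)\<^sup>2 + real k * T ^ (k - 1) * (x - y)\<^sup>2
      = 1/2 * real (Suc k) * (real (Suc k) - 1) * T ^ (Suc k - 2) * (x - y)\<^sup>2"
    by (cases k) (simp_all add: algebra_simps)
  moreover have "0 \<le> x * R k + real k * y ^ (k - 1) * (x - y)\<^sup>2"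
    using Suc assms by simp
  ultimately show ?case using rec 1 2 by linarith
qed

text \<open>The mean minimises the mean square deviation, and every value lies within
  \<open>d\<close> of the midrange \<open>c\<close>. Using half the range instead of the full range
  \<open>2 * d\<close> saves the factor 4 that the form of \<open>eps\<close> requires.\<close>

lemma popoviciu_inequality:
  fixes \<mu> X :: "'a \<Rightarrow> real"
  assumes "finite S" "\<And>i. i \<in> S \<Longrightarrow> 0 \<le> \<mu> i" "sum \<mu> S = 1"
    and diff: "\<And>i j. i \<in> S \<Longrightarrow> j \<in> S \<Longrightarrow> \<bar>X i - X j\<bar> \<le> 2 * d"
  shows "(\<Sum>i\<in>S. \<mu> i * (X i - (\<Sum>j\<in>S. \<mu> j * X j))\<^sup>2) \<le> d\<^sup>2"
proof -
  have ne: "S \<noteq> {}" using assms(3) by auto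
  define c where "c = (Max (X ` S) + Min (X ` S)) / 2"
  define b where "b = (\<Sum>j\<in>S. \<mu> j * X j)"
  have "Max (X ` S) \<in> X ` S" "Min (X ` S) \<in> X ` S"
    using ne assms(1) by (auto intro!: Max_in Min_in)
  then have "Max (X ` S) - Min (X ` S) \<le> 2 * d"
    using diff by (metis (no_types, lifting) abs_le_iff imageE)
  then have dev: "\<bar>X i - c\<bar> \<le> d" if "i \<in> S" for i
  proof -
    have "X i \<le> Max (X ` S)" "Min (X ` S) \<le> X i" using that assms(1) by auto
    then show ?thesis using \<open>Max (X ` S) - Min (X ` S) \<le> 2 * d\<close>
      unfolding c_def abs_le_iff by (simp add: field_simps)
  qed
  have "(\<Sum>i\<in>S. \<mu> i * (X i - c)\<^sup>2) = (\<Sum>i\<in>S. \<mu> i * (X i - b)\<^sup>2 + 2 * (b - c) * (\<mu> i * X i)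
       + (c\<^sup>2 - b\<^sup>2) * \<mu> i)"
    by (intro sum.cong) (auto simp: algebra_simps power2_eq_square)
  also have "\<dots> = (\<Sum>i\<in>S. \<mu> i * (X i - b)\<^sup>2) + 2 * (b - c) * b + (c\<^sup>2 - b\<^sup>2)"
    using assms(3) by (simp add: sum.distrib b_def flip: sum_distrib_left)
  also have "\<dots> = (\<Sum>i\<in>S. \<mu> i * (X i - b)\<^sup>2) + (b - c)\<^sup>2"
    by (simp add: algebra_simps power2_eq_square)
  finally have "(\<Sum>i\<in>S. \<mu> i * (X i - b)\<^sup>2) \<le> (\<Sum>i\<in>S. \<mu> i * (X i - c)\<^sup>2)"
    by simp
  also have "\<dots> \<le> (\<Sum>i\<in>S. \<mu> i * d\<^sup>2)"
    using assms(2) dev by (intro sum_mono mult_left_mono) (auto intro!: abs_le_square_iff[THEN iffD1] order.trans[OF dev])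
  also have "\<dots> = d\<^sup>2" using assms(3) by (simp flip: sum_distrib_right)
  finally show ?thesis unfolding b_def .
qed

text \<open>Both sides are compared with \<open>b ^ k\<close>, where \<open>b\<close> is the mean of
  \<open>X\<close>. Moving from \<open>x\<close> to \<open>b\<close> costs the first-order term in
  \<open>\<delta>\<close>. Around the mean, the linear Taylor term averages to zero, so only the
  second-order remainder is left, and this is controlled by the variance. The factors 2 in the
  hypotheses fit quantities of the form 2 + 2 * (inner product).\<close>

lemma power_mixture_error:
  fixes \<mu> X :: "'a \<Rightarrow> real" and x T d \<delta> :: real
  assumes fin: "finite S" and nn: "\<And>i. i \<in> S \<Longrightarrow> 0 \<le> \<mu> i" and one: "sum \<mu> S = 1"
    and X: "\<And>i. i \<in> S \<Longrightarrow> 0 \<le> X i \<and> X i \<le> T"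
    and diff: "\<And>i j. i \<in> S \<Longrightarrow> j \<in> S \<Longrightarrow> \<bar>X i - X j\<bar> \<le> 2 * d"
    and x: "0 \<le> x" "x \<le> T" "\<bar>x - (\<Sum>i\<in>S. \<mu> i * X i)\<bar> \<le> 2 * \<delta>"
  shows "\<bar>x ^ k - (\<Sum>i\<in>S. \<mu> i * X i ^ k)\<bar>
     \<le> 1/2 * real k * (real k - 1) * T ^ (k - 2) * d\<^sup>2 + 2 * real k * T ^ (k - 1) * \<delta>"
proof -
  define b where "b = (\<Sum>i\<in>S. \<mu> i * X i)"
  define C where "C = 1/2 * real k * (real k - 1) * T ^ (k - 2)"
  define R where "R i = X i ^ k - b ^ k - real k * b ^ (k - 1) * (X i - b)" for i
  have T: "0 \<le> T" using x by linarith
  have C0: "0 \<le> C" unfolding C_def using T by (cases k) auto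
  have b0: "0 \<le> b" unfolding b_def using X nn by (intro sum_nonneg) auto
  have "b \<le> (\<Sum>i\<in>S. \<mu> i * T)" unfolding b_def
    using X nn by (intro sum_mono mult_left_mono) auto
  then have bT: "b \<le> T" using one by (simp flip: sum_distrib_right)
  have R: "0 \<le> R i \<and> R i \<le> C * (X i - b)\<^sup>2" if "i \<in> S" for i
    using power_taylor_remainder[of "X i" T b k] X[OF that] b0 bT unfolding R_def C_def by auto
  have "(\<Sum>i\<in>S. \<mu> i * X i ^ k)
      = (\<Sum>i\<in>S. \<mu> i * R i + (b ^ k - real k * b ^ (k - 1) * b) * \<mu> i
           + real k * b ^ (k - 1) * (\<mu> i * X i))"
    unfolding R_def by (intro sum.cong) (auto simp: algebra_simps)
  also have "\<dots> = (\<Sum>i\<in>S. \<mu> i * R i) + b ^ k"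
    using one by (simp add: sum.distrib b_def flip: sum_distrib_left)
  finally have eq: "(\<Sum>i\<in>S. \<mu> i * X i ^ k) - b ^ k = (\<Sum>i\<in>S. \<mu> i * R i)" by simp
  have lo: "0 \<le> (\<Sum>i\<in>S. \<mu> i * R i)" using R nn by (intro sum_nonneg) auto
  have "(\<Sum>i\<in>S. \<mu> i * R i) \<le> (\<Sum>i\<in>S. C * (\<mu> i * (X i - b)\<^sup>2))"
    using R nn by (intro sum_mono) (auto simp: mult.left_commute[of C] intro!: mult_left_mono)
  also have "\<dots> \<le> C * d\<^sup>2"
    using popoviciu_inequality[of S \<mu> X d, OF fin nn one diff] C0
    by (simp add: b_def mult_left_mono flip: sum_distrib_left)
  finally have hi: "(\<Sum>i\<in>S. \<mu> i * R i) \<le> C * d\<^sup>2" .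
  have "\<bar>x ^ k - b ^ k\<bar> \<le> real k * T ^ (k - 1) * \<bar>x - b\<bar>"
    using power_first_order_bound x b0 bT by blast
  also have "\<dots> \<le> real k * T ^ (k - 1) * (2 * \<delta>)"
    using x T unfolding b_def by (intro mult_left_mono) auto
  finally have "\<bar>x ^ k - b ^ k\<bar> \<le> 2 * real k * T ^ (k - 1) * \<delta>" by (simp add: algebra_simps)
  then show ?thesis using eq lo hi unfolding C_def[symmetric] by linarith
qed

section \<open>The function \<open>chi\<close> as a bound for cap heights\<close>

lemma chi_nonneg: "0 \<le> D \<Longrightarrow> 0 \<le> chi D d"
  by (simp add: chi_def)

lemma chi_mono: "0 \<le> D \<Longrightarrow> 0 \<le> d \<Longrightarrow> d \<le> d' \<Longrightarrow> chi D d \<le> chi D d'"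
  unfolding chi_def by (intro add_mono divide_right_mono power_mono) auto

text \<open>A circle of diameter \<open>d\<close> on the unit sphere lies in a plane whose squared
  distance from the origin is \<open>1 - d^2 / 4\<close>, so this bounds the height of a cap. In
  \<open>s = d^2 / 4\<close> the bound is the increasing polynomial \<open>s / 2 + s^2\<close>. At
  \<open>r = 1 - h^2\<close> it exceeds \<open>1 - h\<close> by a multiple of
  \<open>(1 - h)^2\<close>.\<close>

lemma one_minus_le_chi:
  fixes h :: real
  assumes "0 \<le> h" "h \<le> 1" "0 \<le> d" "1 - d\<^sup>2 / 4 \<le> h\<^sup>2"
  shows "1 - h \<le> chi 2 d"
proof -
  define s where "s = d\<^sup>2 / 4"
  have chi: "chi 2 d = s / 2 + s\<^sup>2"
    by (simp add: chi_def s_def power_divide eval_nat_numeral)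
  have s0: "0 \<le> s" unfolding s_def by simp
  have s1: "1 - h\<^sup>2 \<le> s" using assms(4) unfolding s_def by simp
  define r where "r = 1 - h\<^sup>2"
  have r: "0 \<le> r" unfolding r_def using assms by (simp add: power_le_one)
  have "r / 2 + r\<^sup>2 \<le> s / 2 + s\<^sup>2"
    using s1 r unfolding r_def[symmetric] by (intro add_mono power_mono) auto
  moreover have "r / 2 + r\<^sup>2 - (1 - h) = (1 - h)\<^sup>2 * (h * (h + 2) + 1/2)"
    unfolding r_def by (simp add: field_simps power2_eq_square)
  moreover have "0 \<le> (1 - h)\<^sup>2 * (h * (h + 2) + 1/2)"
    using assms by (intro mult_nonneg_nonneg) auto
  ultimately show ?thesis unfolding chi by linarith
qed

section \<open>Stereographic projection\<close>

text \<open>Since \<open>hat\<close> is given by \<open>inv_into\<close>, the explicit formula needs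
  three facts: the candidate \<open>w\<close> lies on the punctured sphere, \<open>stereo\<close>
  maps it to \<open>p\<close>, and \<open>stereo\<close> is injective there.\<close>

lemma hat_eq:
  "hat p = (2 * fst p / (1 + p \<bullet> p), 2 * snd p / (1 + p \<bullet> p), (p \<bullet> p - 1) / (1 + p \<bullet> p))"
proof -
  obtain x y where p: "p = (x, y)" by (cases p)
  define s where "s = x\<^sup>2 + y\<^sup>2"
  have s: "p \<bullet> p = s" by (simp add: p s_def power2_eq_square)
  have s0: "0 \<le> s" unfolding s_def by simp
  define w :: pt3 where "w = (2 * x / (1 + s), 2 * y / (1 + s), (s - 1) / (1 + s))"
  have "(2 * x / (1 + s))\<^sup>2 + ((2 * y / (1 + s))\<^sup>2 + ((s - 1) / (1 + s))\<^sup>2)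
      = (4 * s + (s - 1)\<^sup>2) / (1 + s)\<^sup>2"
    by (simp add: power_divide add_divide_distrib s_def power_mult_distrib algebra_simps)
  also have "4 * s + (s - 1)\<^sup>2 = (1 + s)\<^sup>2" by (simp add: power2_eq_square algebra_simps)
  also have "(1 + s)\<^sup>2 / (1 + s)\<^sup>2 = 1" using s0 by simp
  finally have "w \<in> sphere 0 1"
    unfolding w_def by (simp add: norm_Pair del: abs_divide)
  moreover have "(s - 1) / (1 + s) \<noteq> 1" using s0 by (simp add: divide_eq_eq)
  then have "w \<noteq> north" by (auto simp: w_def north_def)
  moreover have "stereo w = p"
  proof -
    have "1 - (s - 1) / (1 + s) = 2 / (1 + s)" using s0 by (simp add: field_simps)
    moreover have "2 * t / (1 + s) / (2 / (1 + s)) = t" for t using s0 by simp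
    ultimately show ?thesis unfolding stereo_def w_def p by (simp only: prod.case)
  qed
  moreover have "inj_on stereo (sphere 0 1 - {north})"
  proof (rule inj_onI)
    fix u v :: pt3
    \<comment> \<open>On the sphere, 1 plus the squared norm of \<open>stereo t\<close> equals 2 /
      (1 - Z), where Z is the height of \<open>t\<close>. So \<open>stereo t\<close> determines Z,
      and then the other two coordinates.\<close>
    have *: "snd (snd t) \<noteq> 1 \<and> (1 + stereo t \<bullet> stereo t) * (1 - snd (snd t)) = 2 \<and>
        fst t = fst (stereo t) * (1 - snd (snd t)) \<and> fst (snd t) = snd (stereo t) * (1 - snd (snd t))"
      if "t \<in> sphere 0 1 - {north}" for t :: pt3
    proof -
      obtain X Y Z where t: "t = (X, Y, Z)" by (cases t)
      have n: "X\<^sup>2 + Y\<^sup>2 + Z\<^sup>2 = 1" using that by (simp add: t norm_Pair add.assoc)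
      have Z: "Z \<noteq> 1"
      proof
        assume "Z = 1"
        then have "X\<^sup>2 + Y\<^sup>2 = 0" using n by simp
        then have "t = north" using \<open>Z = 1\<close> by (simp add: t north_def)
        then show False using that by simp
      qed
      have st: "stereo t \<bullet> stereo t = (1 - Z\<^sup>2) / (1 - Z)\<^sup>2"
      proof -
        have "stereo t \<bullet> stereo t = (X\<^sup>2 + Y\<^sup>2) / (1 - Z)\<^sup>2"
          by (simp add: stereo_def t add_divide_distrib power2_eq_square)
        moreover have "X\<^sup>2 + Y\<^sup>2 = 1 - Z\<^sup>2" using n by simp
        ultimately show ?thesis by simp
      qed
      have "(1 + (1 - Z\<^sup>2) / (1 - Z)\<^sup>2) * (1 - Z) = 2"
        using Z by (simp add: divide_simps) (simp add: algebra_simps power2_eq_square)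
      then show ?thesis using Z st by (simp add: t stereo_def)
    qed
    assume u: "u \<in> sphere 0 1 - {north}" and v: "v \<in> sphere 0 1 - {north}" and eq: "stereo u = stereo v"
    have "1 + stereo u \<bullet> stereo u > 0" by (simp add: add_pos_nonneg)
    moreover have "(1 + stereo u \<bullet> stereo u) * (1 - snd (snd u)) = (1 + stereo u \<bullet> stereo u) * (1 - snd (snd v))"
      using *[OF u] *[OF v] eq by metis
    ultimately have "snd (snd u) = snd (snd v)" by simp
    then show "u = v" using *[OF u] *[OF v] eq by (metis prod.collapse)
  qed
  ultimately have "hat p = w"
    unfolding hat_def by (intro inv_into_f_eq) auto
  then show ?thesis unfolding w_def s by (simp add: p)
qed

lemma one_plus_inner_pos: "0 < 1 + p \<bullet> (p :: 'a :: real_inner)"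
  by (simp add: add_pos_nonneg)

lemma inner_hat_hat: "hat p \<bullet> hat q = 1 - 2 * (norm (p - q))\<^sup>2 / ((1 + p \<bullet> p) * (1 + q \<bullet> q))"
proof -
  define P where "P = 1 + p \<bullet> p"
  define Q where "Q = 1 + q \<bullet> q"
  have P: "P > 0" and Q: "Q > 0" unfolding P_def Q_def by (rule one_plus_inner_pos)+
  have 1: "(norm (p - q))\<^sup>2 = (P - 1) + (Q - 1) - 2 * (p \<bullet> q)"
    by (simp add: power2_norm_eq_inner inner_diff inner_commute P_def Q_def)
  have "hat p \<bullet> hat q = (4 * (p \<bullet> q) + (P - 2) * (Q - 2)) / (P * Q)"
    by (simp add: hat_eq P_def[symmetric] Q_def[symmetric] inner_prod_def add_divide_distrib)
      (simp add: P_def Q_def inner_prod_def algebra_simps)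
  then show ?thesis unfolding 1 P_def[symmetric] Q_def[symmetric]
    using P Q by (simp add: field_simps)
qed

lemma inner_hat_north: "hat p \<bullet> north = (p \<bullet> p - 1) / (1 + p \<bullet> p)"
  by (simp add: hat_eq north_def)

lemma norm_hat [simp]: "norm (hat p) = 1"
  using inner_hat_hat[of p p] by (simp add: norm_eq_1)

lemma norm_north [simp]: "norm north = 1"
  by (simp add: north_def norm_Pair)

lemma dist_hat_square: "(dist (hat p) (hat q))\<^sup>2 = 4 * (norm (p - q))\<^sup>2 / ((1 + p \<bullet> p) * (1 + q \<bullet> q))"
proof -
  have "hat p \<bullet> hat p = 1" "hat q \<bullet> hat q = 1"
    using norm_hat[of p] norm_hat[of q] by (simp_all only: norm_eq_1)
  then show ?thesis
    by (simp add: dist_norm power2_norm_eq_inner inner_diff inner_commute inner_hat_hat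
        del: norm_hat)
qed

text \<open>
  Points of a circle with centre \<open>c\<close> satisfy \<open>q \<bullet> q = 2 * (c \<bullet> q) - K\<close> with
  \<open>K = c \<bullet> c - r\<^sup>2\<close>, so \<open>hat\<close> agrees on them with a projective map, and projective maps preserve
  convex hulls.
\<close>

lemma projective_convex_hull:
  fixes V :: "pt2 set"
  assumes circ: "\<And>q. q \<in> V \<Longrightarrow> q \<bullet> q = 2 * (c \<bullet> q) - K" and s: "s \<in> convex hull V"
  defines "D \<equiv> \<lambda>s. 1 + 2 * (c \<bullet> s) - K"
  shows "D s > 0 \<and> (2 * fst s / D s, 2 * snd s / D s, (D s - 2) / D s) \<in> convex hull (hat ` V)"
proof -
  define \<phi> :: "pt2 \<Rightarrow> pt3" where "\<phi> s = (1 / D s) *\<^sub>R (2 * fst s, 2 * snd s, D s - 2)" for s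
  \<comment> \<open>Positivity of the denominator is carried along in \<open>S\<close>, since
    convexity of \<open>S\<close> depends on it.\<close>
  define S where "S = {s. D s > 0 \<and> \<phi> s \<in> convex hull (hat ` V)}"
  have "V \<subseteq> S"
  proof
    fix q assume q: "q \<in> V"
    then have "D q = 1 + q \<bullet> q" unfolding D_def using circ by simp
    then have "\<phi> q = hat q" "D q > 0"
      by (auto simp: \<phi>_def hat_eq one_plus_inner_pos)
    then show "q \<in> S" unfolding S_def using q by (auto intro: hull_inc)
  qed
  moreover have "convex S"
  proof (rule convexI)
    fix x y and u v :: real
    assume x: "x \<in> S" and y: "y \<in> S" and uv: "0 \<le> u" "0 \<le> v" "u + v = 1"
    define z where "z = u *\<^sub>R x + v *\<^sub>R y"
    have Dx: "D x > 0" and Dy: "D y > 0" using x y by (auto simp: S_def)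
    have Dz: "D z = u * D x + v * D y"
    proof -
      have "D z = (u + v) * (1 - K) + 2 * (c \<bullet> z)" using uv by (simp add: D_def)
      then show ?thesis by (simp add: D_def z_def inner_add_right algebra_simps)
    qed
    have Dz0: "D z > 0"
    proof (cases "u = 0")
      case True then show ?thesis using Dz uv Dy by simp
    next
      case False
      then show ?thesis unfolding Dz using uv Dx Dy by (intro add_pos_nonneg) auto
    qed
    \<comment> \<open>The map is not affine: the weights \<open>u\<close>, \<open>v\<close> get
      multiplied by the denominators \<open>D x\<close>, \<open>D y\<close>. They still sum to 1
      after division by \<open>D z\<close>, because \<open>D\<close> is affine.\<close>
    have "\<phi> z = (u * D x / D z) *\<^sub>R \<phi> x + (v * D y / D z) *\<^sub>R \<phi> y"
    proof -
      have "D z - 2 * (u + v) = u * (D x - 2) + v * (D y - 2)"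
        unfolding Dz by (simp add: algebra_simps)
      then have "D z - 2 = u * (D x - 2) + v * (D y - 2)" using uv by simp
      then have "(2 * fst z, 2 * snd z, D z - 2)
          = u *\<^sub>R (2 * fst x, 2 * snd x, D x - 2) + v *\<^sub>R (2 * fst y, 2 * snd y, D y - 2)"
        by (simp add: z_def)
      then have "\<phi> z = (1 / D z) *\<^sub>R
          (u *\<^sub>R (2 * fst x, 2 * snd x, D x - 2) + v *\<^sub>R (2 * fst y, 2 * snd y, D y - 2))"
        unfolding \<phi>_def by (rule arg_cong)
      then show ?thesis
        unfolding \<phi>_def scaleR_add_right scaleR_scaleR using Dx Dy by simp
    qed
    moreover have "u * D x / D z + v * D y / D z = 1"
      using Dz Dz0 by (simp flip: add_divide_distrib)
    ultimately have "\<phi> z \<in> convex hull (hat ` V)"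
      using x y uv Dx Dy Dz0 by (auto simp: S_def intro!: convexD)
    then show "u *\<^sub>R x + v *\<^sub>R y \<in> S"
      using Dz0 unfolding S_def z_def by simp
  qed
  ultimately have "convex hull V \<subseteq> S" by (rule hull_minimal)
  then show ?thesis using s by (auto simp: S_def \<phi>_def)
qed

lemma norm_convex_hull_le_1:
  assumes "z \<in> convex hull (hat ` V)"
  shows "norm z \<le> 1"
proof -
  have "convex hull (hat ` V) \<subseteq> cball 0 1" by (intro hull_minimal) auto
  then show ?thesis using assms by auto
qed

text \<open>The point \<open>z\<close> is where the ray through \<open>hat p\<close> meets the plane spanned by \<open>hat ` V\<close>;
  \<open>n\<close> is a normal vector of that plane.\<close>

lemma radial_approximation:
  fixes V :: "pt2 set" and c p :: pt2
  assumes circ: "\<And>q. q \<in> V \<Longrightarrow> q \<bullet> q = 2 * (c \<bullet> q) - K"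
    and K: "K > -1" and E: "E = 2 * (c \<bullet> p) - K - p \<bullet> p" "E \<ge> 0"
    and hull: "((1 + K) / (1 + K + E)) *\<^sub>R p \<in> convex hull V"
    and d: "0 \<le> d" "16 * (c \<bullet> c - K) / (4 * (c \<bullet> c) + (1 - K)\<^sup>2) \<le> d\<^sup>2"
  shows "\<exists>z \<in> convex hull (hat ` V). norm (hat p - z) \<le> chi 2 d"
proof -
  \<comment> \<open>For the circle with centre \<open>c\<close> and squared radius
    \<open>c \<bullet> c - K\<close>, the number \<open>E\<close> is the squared radius minus the
    squared distance of \<open>p\<close> from \<open>c\<close>. The factor \<open>\<kappa>\<close>
    is the one for which the projective image of \<open>\<kappa> *\<^sub>R p\<close> is a multiple
    of \<open>hat p\<close>.\<close>
  define \<kappa> where "\<kappa> = (1 + K) / (1 + K + E)"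
  have den: "1 + K + E > 0" using K E by simp
  have \<kappa>: "\<kappa> > 0" unfolding \<kappa>_def using K E by simp
  have \<kappa>E: "\<kappa> * (1 + K + E) = 1 + K" unfolding \<kappa>_def using den by simp
  define D where "D = 1 + 2 * (c \<bullet> (\<kappa> *\<^sub>R p)) - K"
  define z :: pt3 where "z = (2 * fst (\<kappa> *\<^sub>R p) / D, 2 * snd (\<kappa> *\<^sub>R p) / D, (D - 2) / D)"
  have D: "D > 0" and z: "z \<in> convex hull (hat ` V)"
    using projective_convex_hull[OF circ hull] unfolding D_def \<kappa>_def z_def by auto
  have D2: "D - 2 = \<kappa> * (p \<bullet> p - 1)"
  proof -
    have "\<kappa> * (2 * (c \<bullet> p) - p \<bullet> p + 1) = 1 + K" using \<kappa>E E by (simp add: algebra_simps)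
    then show ?thesis unfolding D_def by (simp add: algebra_simps)
  qed
  define \<mu> where "\<mu> = \<kappa> * (1 + p \<bullet> p) / D"
  have \<mu>0: "\<mu> > 0" unfolding \<mu>_def using \<kappa> D one_plus_inner_pos[of p] by simp
  have zh: "z = \<mu> *\<^sub>R hat p"
    using one_plus_inner_pos[of p] D unfolding z_def D2 by (simp add: hat_eq \<mu>_def)
  then have nz: "norm z = \<mu>" using \<mu>0 by simp
  have \<mu>1: "\<mu> \<le> 1" using norm_convex_hull_le_1[OF z] nz by simp
  define n :: pt3 where "n = (- 2 * fst c, - 2 * snd c, 1 - K)"
  have nn: "(norm n)\<^sup>2 = 4 * (c \<bullet> c) + (1 - K)\<^sup>2"
    unfolding power2_norm_eq_inner
    by (simp add: n_def inner_prod_def power2_eq_square algebra_simps)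
  \<comment> \<open>The plane has distance \<open>(1 + K) / norm n\<close> from the origin, so
    Cauchy-Schwarz bounds \<open>\<mu> = norm z\<close> below by it. The hypothesis on
    \<open>d\<close> says that the square of this distance is at least
    \<open>1 - d^2 / 4\<close>.\<close>
  have "n \<bullet> z = - (1 + K)"
  proof -
    have "n \<bullet> z * D = - 4 * (c \<bullet> (\<kappa> *\<^sub>R p)) + (1 - K) * (D - 2)"
      using D by (simp add: n_def z_def inner_prod_def field_simps)
    also have "\<dots> = - 2 * (D - 1 + K) + (1 - K) * (D - 2)" unfolding D_def by simp
    finally have "n \<bullet> z * D = - (1 + K) * D" by (simp add: algebra_simps)
    then show ?thesis using D by simp
  qed
  then have "1 + K \<le> norm n * \<mu>"
    using Cauchy_Schwarz_ineq2[of n z] nz K by simp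
  then have "(1 + K)\<^sup>2 \<le> (norm n * \<mu>)\<^sup>2" using K by (intro power_mono) auto
  then have CS: "(1 + K)\<^sup>2 \<le> (norm n)\<^sup>2 * \<mu>\<^sup>2" by (simp add: power_mult_distrib)
  have n0: "(norm n)\<^sup>2 > 0"
    using CS K by (smt (verit) mult_eq_0_iff zero_le_power2 zero_less_power)
  have "1 - d\<^sup>2 / 4 \<le> 1 - 4 * (c \<bullet> c - K) / (norm n)\<^sup>2"
    using d unfolding nn by simp
  also have "\<dots> = (1 + K)\<^sup>2 / (norm n)\<^sup>2"
  proof -
    have "(norm n)\<^sup>2 - 4 * (c \<bullet> c - K) = (1 + K)\<^sup>2"
      unfolding nn by (simp add: power2_eq_square algebra_simps)
    then show ?thesis using n0 by (simp add: field_simps)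
  qed
  also have "\<dots> \<le> \<mu>\<^sup>2" using CS n0 by (simp add: divide_le_eq mult.commute)
  finally have "1 - \<mu> \<le> chi 2 d"
    using one_minus_le_chi[of \<mu> d] \<mu>0 \<mu>1 d by simp
  moreover have "hat p - z = (1 - \<mu>) *\<^sub>R hat p" unfolding zh by (simp add: algebra_simps)
  then have "norm (hat p - z) = 1 - \<mu>" using \<mu>1 by simp
  ultimately show ?thesis using z by (intro bexI[of _ z]) auto
qed

text \<open>Only a lower bound on the diameter is needed. By symmetry, the two points of the
  boundary circle on the line through the origin and \<open>c\<close> have images that are opposite
  on the image circle, and their squared distance is exactly the left-hand side.\<close>

lemma diameter_hat_cball:
  fixes c :: pt2
  assumes r: "0 \<le> r"
  shows "0 \<le> diameter (hat ` cball c r)"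
    and "16 * r\<^sup>2 / (4 * (c \<bullet> c) + (1 - (c \<bullet> c - r\<^sup>2))\<^sup>2) \<le> (diameter (hat ` cball c r))\<^sup>2"
proof -
  have bdd: "bounded (hat ` cball c r)"
    by (rule bounded_subset[of "cball 0 1"]) auto
  show "0 \<le> diameter (hat ` cball c r)" using diameter_ge_0[OF bdd] .
  \<comment> \<open>When \<open>c\<close> is the origin every direction serves, so some unit vector
    is chosen.\<close>
  obtain e :: pt2 where e: "norm e = 1" "c = norm c *\<^sub>R e"
  proof (cases "c = 0")
    case True
    then show ?thesis using that[of "(1, 0)"] by (simp add: norm_Pair zero_prod_def)
  next
    case False
    then show ?thesis using that[of "c /\<^sub>R norm c"] by simp
  qed
  define g where "g = norm c"
  have ee: "e \<bullet> e = 1" using e by (simp add: norm_eq_1)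
  define p where "p = (g + r) *\<^sub>R e"
  define q where "q = (g - r) *\<^sub>R e"
  have "c - p = (- r) *\<^sub>R e" "c - q = r *\<^sub>R e"
    using e(2) unfolding p_def q_def g_def by (simp_all add: algebra_simps)
  then have "p \<in> cball c r" "q \<in> cball c r" using e r by (auto simp: dist_norm)
  then have dd: "dist (hat p) (hat q) \<le> diameter (hat ` cball c r)"
    using diameter_bounded_bound[OF bdd] by blast
  have pq: "norm (p - q) = 2 * r"
  proof -
    have "p - q = (2 * r) *\<^sub>R e" unfolding p_def q_def by (simp add: algebra_simps flip: scaleR_add_left)
    then show ?thesis using e r by simp
  qed
  have pp: "p \<bullet> p = (g + r)\<^sup>2" "q \<bullet> q = (g - r)\<^sup>2"
    using ee by (simp_all add: p_def q_def power2_eq_square)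
  have cc: "c \<bullet> c = g\<^sup>2" unfolding g_def by (simp add: power2_norm_eq_inner)
  have "(1 + (g + r)\<^sup>2) * (1 + (g - r)\<^sup>2) = 4 * g\<^sup>2 + (1 - (g\<^sup>2 - r\<^sup>2))\<^sup>2"
    by (simp add: power2_eq_square algebra_simps)
  then have "16 * r\<^sup>2 / (4 * (c \<bullet> c) + (1 - (c \<bullet> c - r\<^sup>2))\<^sup>2) = (dist (hat p) (hat q))\<^sup>2"
    unfolding dist_hat_square pq pp cc by (simp add: power_mult_distrib)
  also have "\<dots> \<le> (diameter (hat ` cball c r))\<^sup>2" using dd by (intro power_mono) auto
  finally show "16 * r\<^sup>2 / (4 * (c \<bullet> c) + (1 - (c \<bullet> c - r\<^sup>2))\<^sup>2) \<le> (diameter (hat ` cball c r))\<^sup>2" .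
qed

section \<open>Arcs over edges\<close>

text \<open>The assumptions say that the component \<open>e\<close> of \<open>w - m\<close> orthogonal to the chord, where \<open>m\<close>
  is the midpoint of the chord, satisfies \<open>e \<bullet> m \<ge> a * norm e\<close>; here \<open>M = e \<bullet> m\<close>.  The constant
  \<open>16/13\<close> is the square of the smallest diameter of a circle that is the image of a line at distance
  at most \<open>3/2\<close> from the origin.\<close>

lemma chord_approximation:
  fixes u v w :: "'a :: real_inner"
  assumes unit: "norm u = 1" "norm v = 1" "norm w = 1"
    and d: "d = norm (u - v)" "0 < d" "d \<le> 1"
    and M: "M = w \<bullet> (u + v) / 2 - 1 + d\<^sup>2 / 4" "0 \<le> M"
    and a: "0 < a" "16/13 - d\<^sup>2 \<le> 4 * a\<^sup>2"
    and Ma: "a\<^sup>2 * (d\<^sup>2 / 4 - (w \<bullet> (v - u))\<^sup>2 / d\<^sup>2 - 2 * M) \<le> M\<^sup>2"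
  shows "\<exists>z \<in> closed_segment u v. norm (w - z) \<le> chi 1 d"
proof -
  \<comment> \<open>\<open>z\<close> is the foot of the perpendicular from \<open>w\<close> to the
    line through \<open>u\<close> and \<open>v\<close>, and \<open>\<tau>\<close> is its position
    relative to the midpoint in units of \<open>v - u\<close>.\<close>
  define \<tau> where "\<tau> = w \<bullet> (v - u) / d\<^sup>2"
  define m where "m = (1/2) *\<^sub>R (u + v)"
  define z where "z = m + \<tau> *\<^sub>R (v - u)"
  define e where "e = w - z"
  have uu: "u \<bullet> u = 1" "v \<bullet> v = 1" "w \<bullet> w = 1" using unit by (simp_all add: norm_eq_1)
  have dd: "d\<^sup>2 = 2 - 2 * (u \<bullet> v)"
    using uu d(1) by (simp add: power2_norm_eq_inner inner_diff inner_commute)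
  have g: "(v - u) \<bullet> (v - u) = d\<^sup>2" "m \<bullet> (v - u) = 0" "m \<bullet> m = 1 - d\<^sup>2 / 4"
    using uu unfolding dd m_def by (simp_all add: inner_diff inner_add inner_commute field_simps)
  have wm: "w \<bullet> m = M + 1 - d\<^sup>2 / 4"
    using M(1) by (simp add: m_def)
  have wv: "w \<bullet> (v - u) = \<tau> * d\<^sup>2" using d(2) by (simp add: \<tau>_def)
  have "e \<bullet> e = w \<bullet> w - 2 * (w \<bullet> z) + z \<bullet> z"
    by (simp add: e_def inner_diff inner_commute)
  also have "w \<bullet> z = M + 1 - d\<^sup>2 / 4 + \<tau> * (\<tau> * d\<^sup>2)"
    by (simp only: z_def inner_add_right inner_scaleR_right wm wv)
  also have "z \<bullet> z = 1 - d\<^sup>2 / 4 + \<tau> * (\<tau> * d\<^sup>2)"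
    using g by (simp add: z_def inner_add_right inner_add_left inner_commute[of "v - u" m])
  finally have ee: "e \<bullet> e = d\<^sup>2 / 4 - \<tau>\<^sup>2 * d\<^sup>2 - 2 * M"
    using uu by (simp add: power2_eq_square)
  have \<tau>d: "(w \<bullet> (v - u))\<^sup>2 / d\<^sup>2 = \<tau>\<^sup>2 * d\<^sup>2"
    unfolding wv using d(2) by (simp add: power2_eq_square)
  \<comment> \<open>Together with \<open>M \<ge> 0\<close>, nonnegativity of
    \<open>e \<bullet> e\<close> puts the foot \<open>z\<close> inside the chord.\<close>
  have "\<tau>\<^sup>2 * d\<^sup>2 \<le> 1/4 * d\<^sup>2" using ee M(2) inner_ge_zero[of e] by linarith
  then have "\<tau>\<^sup>2 \<le> (1/2)\<^sup>2" using d(2) by (simp add: power2_eq_square)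
  then have \<tau>: "\<bar>\<tau>\<bar> \<le> 1/2" by (simp add: power2_le_iff_abs_le)
  have zseg: "z \<in> closed_segment u v"
  proof -
    have "z = (1 - (1/2 + \<tau>)) *\<^sub>R u + (1/2 + \<tau>) *\<^sub>R v"
      by (simp add: z_def m_def algebra_simps)
    moreover have "0 \<le> 1/2 + \<tau>" "1/2 + \<tau> \<le> 1" using \<tau> by linarith+
    ultimately show ?thesis unfolding closed_segment_def by blast
  qed
  have "(a * norm e)\<^sup>2 \<le> M\<^sup>2"
    using Ma unfolding \<tau>d ee[symmetric] by (simp add: power_mult_distrib power2_norm_eq_inner)
  then have "a * norm e \<le> M" using M(2) by (rule power2_le_imp_le)
  moreover have "0 \<le> \<tau>\<^sup>2 * d\<^sup>2" by simp
  then have "2 * M \<le> d\<^sup>2 / 4" using ee inner_ge_zero[of e] by linarith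
  ultimately have ne: "8 * a * norm e \<le> d\<^sup>2" by linarith
  define s where "s = d\<^sup>2"
  have s: "0 \<le> s" "s \<le> 1" using d by (auto simp: s_def power_le_one)
  \<comment> \<open>Since \<open>chi 1 d = s * (1 + 2 * s) / 4\<close> and
    \<open>8 * a * norm e \<le> s\<close>, it is enough that
    \<open>(1 + 2 * s) * (2 * a) \<ge> 1\<close>. The hypothesis on \<open>a\<close> reduces this to
    a cubic inequality for \<open>s\<close> between 0 and 1.\<close>
  have "1 \<le> (1 + 2 * s)\<^sup>2 * (16/13 - s)"
  proof -
    have "s * s \<le> 1 * s" "s\<^sup>2 * s \<le> s\<^sup>2 * 1" using s by (intro mult_right_mono mult_left_mono; simp)+
    then have "0 \<le> 3 + 51 * s + 12 * s\<^sup>2 - 52 * (s\<^sup>2 * s)" using s by (simp add: power2_eq_square)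
    moreover have "13 * ((1 + 2 * s)\<^sup>2 * (16/13 - s)) - 13 = 3 + 51 * s + 12 * s\<^sup>2 - 52 * (s\<^sup>2 * s)"
      by (simp add: power2_eq_square algebra_simps)
    ultimately show ?thesis by linarith
  qed
  also have "\<dots> \<le> (1 + 2 * s)\<^sup>2 * (4 * a\<^sup>2)"
    using a(2) unfolding s_def by (intro mult_left_mono) auto
  also have "\<dots> = ((1 + 2 * s) * (2 * a))\<^sup>2" by (simp add: power_mult_distrib)
  finally have "1\<^sup>2 \<le> ((1 + 2 * s) * (2 * a))\<^sup>2" by simp
  then have "1 \<le> (1 + 2 * s) * (2 * a)"
    by (rule power2_le_imp_le) (use s a in auto)
  then have "norm e * 1 \<le> norm e * ((1 + 2 * s) * (2 * a))" by (intro mult_left_mono) auto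
  also have "\<dots> = (1 + 2 * s) / 4 * (8 * a * norm e)" by (simp add: algebra_simps)
  also have "\<dots> \<le> (1 + 2 * s) / 4 * s" using ne s unfolding s_def by (intro mult_left_mono) auto
  also have "\<dots> = chi 1 d"
    by (simp add: chi_def s_def field_simps eval_nat_numeral)
  finally show ?thesis using zseg unfolding e_def by auto
qed

text \<open>In the notation of \<open>edge_approximation\<close> below, with \<open>\<sigma> = x0 + x1\<close> and \<open>\<pi> = x0 * x1\<close>: the
  squared distance from \<open>hat p\<close> to the line through \<open>hat a\<close> and \<open>hat b\<close> (up to a factor), split into
  its components orthogonal to the plane through \<open>hat a\<close>, \<open>hat b\<close>, \<open>north\<close> and inside it.\<close>

lemma chord_distance_identity:
  fixes \<sigma> \<pi> x y Y :: real
  defines "c \<equiv> 1 + y\<^sup>2"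
  defines "S \<equiv> c + \<pi>" and "L2 \<equiv> \<sigma>\<^sup>2 - 4 * \<pi>" and "\<eta> \<equiv> \<sigma> * x - x\<^sup>2 - \<pi> - Y\<^sup>2"
    and "P \<equiv> c + x\<^sup>2 + 2 * y * Y + Y\<^sup>2" and "k \<equiv> c * (2 * x - \<sigma>) + x * (x * \<sigma> - 2 * \<pi>) + Y\<^sup>2 * \<sigma>"
  shows "c * (L2 * P\<^sup>2 - 2 * (2 * S * \<eta> + 2 * y * L2 * Y) * P - k\<^sup>2) =
      4 * Y\<^sup>2 * (S\<^sup>2 + c * L2) + 4 * (c * \<eta> - y * Y * S)\<^sup>2"
  unfolding k_def P_def \<eta>_def L2_def S_def c_def
  by (simp add: power2_eq_square algebra_simps)
text \<open>The scalars are coordinates of \<open>a = (x0, y0)\<close>, \<open>b = (x1, y0)\<close>, \<open>p = (x, y)\<close> up to a symmetry of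
  the square lattice.  Assumption \<open>cross\<close> says that \<open>hat p\<close> lies between the plane through \<open>hat a\<close>,
  \<open>hat b\<close> and the north pole and the plane through \<open>hat a\<close>, \<open>hat b\<close> and the origin.\<close>

lemma edge_approximation:
  fixes a b p :: pt2
  assumes inners: "a \<bullet> a = x0\<^sup>2 + y0\<^sup>2" "b \<bullet> b = x1\<^sup>2 + y0\<^sup>2" "p \<bullet> p = x\<^sup>2 + y\<^sup>2"
      "a \<bullet> b = x0 * x1 + y0\<^sup>2" "p \<bullet> a = x * x0 + y * y0" "p \<bullet> b = x * x1 + y * y0"
    and x: "x0 < x1" "x1 - x0 \<le> 1/2"
    and y: "0 < y0" "y0 \<le> 3/2" "y0 \<le> y"
    and cross: "(y - y0) * (1 + x0 * x1 + y * y0) \<le> y0 * ((x - x0) * (x1 - x))"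
  shows "\<exists>z \<in> closed_segment (hat a) (hat b). norm (hat p - z) \<le> chi 1 (dist (hat a) (hat b))"
proof -
  have norm_diff: "(norm (u - v))\<^sup>2 = u \<bullet> u + v \<bullet> v - 2 * (u \<bullet> v)" for u v :: pt2
    by (simp add: power2_norm_eq_inner inner_diff inner_commute)
  have norms: "(norm (a - b))\<^sup>2 = (x1 - x0)\<^sup>2" "(norm (p - a))\<^sup>2 = (x - x0)\<^sup>2 + (y - y0)\<^sup>2"
      "(norm (p - b))\<^sup>2 = (x - x1)\<^sup>2 + (y - y0)\<^sup>2"
    unfolding norm_diff inners by (simp_all add: power2_eq_square algebra_simps)
  define c where "c = 1 + y0\<^sup>2"
  define A where "A = c + x0\<^sup>2"
  define B where "B = c + x1\<^sup>2"
  define P where "P = 1 + x\<^sup>2 + y\<^sup>2"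
  define L where "L = x1 - x0"
  define Y where "Y = y - y0"
  define S where "S = c + x0 * x1"
  define \<xi> where "\<xi> = (x - x0) * (x1 - x)"
  define m where "m = 2 * S * (\<xi> - Y\<^sup>2) + 2 * y0 * L\<^sup>2 * Y"
  have c: "1 \<le> c" "c \<le> 13/4"
  proof -
    have "y0\<^sup>2 \<le> (3/2)\<^sup>2" using y by (intro power_mono) auto
    then show "1 \<le> c" "c \<le> 13/4" unfolding c_def by (simp_all add: power2_eq_square)
  qed
  have A: "1 \<le> A" and B: "1 \<le> B" using c unfolding A_def B_def by (simp_all add: add_increasing2)
  have P: "0 < P" unfolding P_def by (simp add: add_pos_nonneg)
  have L: "0 < L" "L \<le> 1/2" using x unfolding L_def by auto
  have Y: "0 \<le> Y" using y unfolding Y_def by simp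
  have AB: "A * B = S\<^sup>2 + c * L\<^sup>2"
    unfolding A_def B_def S_def L_def by (simp add: power2_eq_square algebra_simps)
  have S: "0 < S"
  proof -
    have "L\<^sup>2 \<le> (1/2)\<^sup>2" using L by (intro power_mono) auto
    moreover have "4 * (x0 * x1) = (x0 + x1)\<^sup>2 - L\<^sup>2"
      unfolding L_def by (simp add: power2_eq_square algebra_simps)
    moreover have "0 \<le> (x0 + x1)\<^sup>2" by simp
    moreover have "(1/2 :: real)\<^sup>2 = 1/4" by (simp add: power2_eq_square)
    ultimately show ?thesis unfolding S_def using c by linarith
  qed
  have cr: "Y * S \<le> y0 * (\<xi> - Y\<^sup>2)"
    using cross unfolding Y_def S_def c_def \<xi>_def by (simp add: power2_eq_square algebra_simps)
  have "0 \<le> y0 * (\<xi> - Y\<^sup>2)" using cr Y S by (smt (verit) mult_nonneg_nonneg)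
  then have \<xi>Y: "0 \<le> \<xi> - Y\<^sup>2" using y by (simp add: zero_le_mult_iff)
  then have m0: "0 \<le> m" unfolding m_def using S y Y by simp
  have denoms: "1 + a \<bullet> a = A" "1 + b \<bullet> b = B" "1 + p \<bullet> p = P"
    unfolding inners A_def B_def P_def c_def by simp_all
  define d where "d = dist (hat a) (hat b)"
  have d2: "d\<^sup>2 = 4 * L\<^sup>2 / (A * B)"
    unfolding d_def dist_hat_square denoms unfolding norms L_def ..
  have hpa: "hat p \<bullet> hat a = 1 - 2 * ((x - x0)\<^sup>2 + Y\<^sup>2) / (P * A)"
    and hpb: "hat p \<bullet> hat b = 1 - 2 * ((x - x1)\<^sup>2 + Y\<^sup>2) / (P * B)"
    unfolding inner_hat_hat denoms unfolding norms Y_def by simp_all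
  have AB1: "1 \<le> A * B" using A B mult_mono[of 1 A 1 B] by simp
  have d0: "0 < d" 
  proof -
    have "0 < d\<^sup>2" unfolding d2 using L AB1 by simp
    then show ?thesis unfolding d_def by (simp add: zero_less_power2)
  qed
  have d1: "d \<le> 1"
  proof -
    have "L\<^sup>2 \<le> (1/2)\<^sup>2" using L by (intro power_mono) auto
    then have "4 * L\<^sup>2 \<le> A * B" using AB1 by (simp add: power2_eq_square)
    then have "d\<^sup>2 \<le> 1\<^sup>2" unfolding d2 using AB1 by (simp add: divide_le_eq)
    then show ?thesis by (rule power2_le_imp_le) simp
  qed
  define M where "M = hat p \<bullet> (hat a + hat b) / 2 - 1 + d\<^sup>2 / 4"
  have M: "M = m / (P * A * B)"
  proof -
    have id: "L\<^sup>2 * P - B * ((x - x0)\<^sup>2 + Y\<^sup>2) - A * ((x - x1)\<^sup>2 + Y\<^sup>2) = m"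
      unfolding m_def L_def A_def B_def P_def c_def Y_def S_def \<xi>_def
      by (simp add: power2_eq_square algebra_simps)
    have "M = (L\<^sup>2 * P - B * ((x - x0)\<^sup>2 + Y\<^sup>2) - A * ((x - x1)\<^sup>2 + Y\<^sup>2)) / (P * A * B)"
      unfolding M_def inner_add_right hpa hpb d2 using P A B
      by (simp add: divide_simps) (simp add: algebra_simps)
    then show ?thesis unfolding id .
  qed
  \<comment> \<open>The line through \<open>a\<close> and \<open>b\<close> is mapped to a circle of
    squared radius \<open>1 / c\<close>. As \<open>4 * \<alpha>^2 = 4 / c - d^2\<close>, the number
    \<open>\<alpha>\<close> is the distance from the centre of that circle to the chord.\<close>
  define \<alpha> where "\<alpha> = S / sqrt (c * A * B)"
  have \<alpha>2: "\<alpha>\<^sup>2 = S\<^sup>2 / (c * A * B)"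
    unfolding \<alpha>_def using c A B by (simp add: power_divide)
  have \<alpha>0: "0 < \<alpha>" unfolding \<alpha>_def using S c A B by simp
  have "4 * \<alpha>\<^sup>2 = 4 / c - d\<^sup>2"
  proof -
    have "c * \<alpha>\<^sup>2 * (A * B) = S\<^sup>2" unfolding \<alpha>2 using c A B by simp
    also have "\<dots> = A * B - c * L\<^sup>2" using AB by simp
    finally show ?thesis unfolding d2 using c A B by (simp add: field_simps)
  qed
  moreover have "16/13 \<le> 4 / c" using c by (simp add: field_simps)
  ultimately have \<alpha>d: "16/13 - d\<^sup>2 \<le> 4 * \<alpha>\<^sup>2" by linarith
  define K where "K = B * ((x - x0)\<^sup>2 + Y\<^sup>2) - A * ((x - x1)\<^sup>2 + Y\<^sup>2)"
  have K: "hat p \<bullet> (hat b - hat a) = 2 * K / (P * A * B)"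
    unfolding inner_diff_right hpa hpb K_def using P A B
    by (simp add: divide_simps) (simp add: algebra_simps)
  define k where "k = c * (2 * x - (x0 + x1)) + x * (x * (x0 + x1) - 2 * (x0 * x1)) + Y\<^sup>2 * (x0 + x1)"
  have Kk: "K = L * k"
    unfolding K_def k_def L_def A_def B_def by (simp add: power2_eq_square algebra_simps)
  have split: "c * (L\<^sup>2 * P\<^sup>2 - 2 * m * P - k\<^sup>2) =
      4 * Y\<^sup>2 * (A * B) + 4 * (c * (\<xi> - Y\<^sup>2) - y0 * Y * S)\<^sup>2"
  proof -
    have eqs: "(x0 + x1)\<^sup>2 - 4 * (x0 * x1) = L\<^sup>2" "(x0 + x1) * x - x\<^sup>2 - x0 * x1 - Y\<^sup>2 = \<xi> - Y\<^sup>2"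
        "c + x\<^sup>2 + 2 * y0 * Y + Y\<^sup>2 = P"
      unfolding L_def \<xi>_def P_def c_def Y_def by (simp_all add: power2_eq_square algebra_simps)
    show ?thesis
      using chord_distance_identity[of y0 "x0 + x1" "x0 * x1" x Y]
      unfolding c_def[symmetric] unfolding S_def[symmetric] eqs k_def[symmetric]
      unfolding m_def[symmetric] AB[symmetric] .
  qed
  \<comment> \<open>\<open>X\<close> is the squared distance from \<open>hat p\<close> to the line
    through \<open>hat a\<close> and \<open>hat b\<close>; \<open>chord_approximation\<close> asks
    for \<open>\<alpha>^2 * X \<le> M^2\<close>.\<close>
  define X where "X = d\<^sup>2 / 4 - (hat p \<bullet> (hat b - hat a))\<^sup>2 / d\<^sup>2 - 2 * M"
  have "(hat p \<bullet> (hat b - hat a))\<^sup>2 / d\<^sup>2 = k\<^sup>2 / (P\<^sup>2 * (A * B))"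
    unfolding K Kk d2 using P A B L by (simp add: power2_eq_square field_simps)
  then have "X = L\<^sup>2 / (A * B) - k\<^sup>2 / (P\<^sup>2 * (A * B)) - 2 * (m / (P * A * B))"
    unfolding X_def M d2 by simp
  also have "\<dots> = (L\<^sup>2 * P\<^sup>2 - 2 * m * P - k\<^sup>2) / (P\<^sup>2 * (A * B))"
    using P A B by (simp add: diff_divide_distrib power2_eq_square)
  also have "\<dots> = c * (L\<^sup>2 * P\<^sup>2 - 2 * m * P - k\<^sup>2) / (c * P\<^sup>2 * (A * B))"
    using c by simp
  finally have X: "X = (4 * Y\<^sup>2 * (A * B) + 4 * (c * (\<xi> - Y\<^sup>2) - y0 * Y * S)\<^sup>2) / (c * P\<^sup>2 * (A * B))"
    unfolding split .
  \<comment> \<open>This is the required inequality with denominators cleared. Writing the last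
    square as \<open>(c * m - q * Y)^2\<close> makes the difference of the two sides a product,
    whose only factor of unclear sign is \<open>y0 * m - Y * (S^2 + y0^2 * L^2)\<close>. The
    hypothesis \<open>cross\<close>, in the form \<open>cr\<close>, makes that factor
    nonnegative.\<close>
  have key: "S\<^sup>2 * (4 * Y\<^sup>2 * (A * B) + 4 * (c * (\<xi> - Y\<^sup>2) - y0 * Y * S)\<^sup>2) \<le> c\<^sup>2 * m\<^sup>2"
  proof -
    define q where "q = 2 * y0 * (A * B)"
    have cm: "c * m - q * Y = 2 * S * (c * (\<xi> - Y\<^sup>2) - y0 * Y * S)"
      unfolding m_def q_def AB by (simp add: power2_eq_square algebra_simps)
    have "c\<^sup>2 * m\<^sup>2 - S\<^sup>2 * (4 * Y\<^sup>2 * (A * B) + 4 * (c * (\<xi> - Y\<^sup>2) - y0 * Y * S)\<^sup>2)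
       = (c * m)\<^sup>2 - (2 * S * (c * (\<xi> - Y\<^sup>2) - y0 * Y * S))\<^sup>2 - 4 * S\<^sup>2 * Y\<^sup>2 * (A * B)"
      by (simp add: power2_eq_square algebra_simps)
    also have "\<dots> = (c * m)\<^sup>2 - (c * m - q * Y)\<^sup>2 - 4 * S\<^sup>2 * Y\<^sup>2 * (A * B)"
      unfolding cm ..
    also have "\<dots> = 4 * (A * B) * Y * (c * (y0 * m) - Y * (y0\<^sup>2 * (A * B) + S\<^sup>2))"
      unfolding q_def by (simp add: power2_eq_square algebra_simps)
    also have "y0\<^sup>2 * (A * B) + S\<^sup>2 = c * (S\<^sup>2 + y0\<^sup>2 * L\<^sup>2)"
      unfolding AB by (simp add: c_def power2_eq_square algebra_simps)
    also have "4 * (A * B) * Y * (c * (y0 * m) - Y * (c * (S\<^sup>2 + y0\<^sup>2 * L\<^sup>2)))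
       = 4 * (A * B) * Y * c * (y0 * m - Y * (S\<^sup>2 + y0\<^sup>2 * L\<^sup>2))"
      by (simp add: algebra_simps)
    finally have id: "c\<^sup>2 * m\<^sup>2 - S\<^sup>2 * (4 * Y\<^sup>2 * (A * B) + 4 * (c * (\<xi> - Y\<^sup>2) - y0 * Y * S)\<^sup>2)
       = 4 * (A * B) * Y * c * (y0 * m - Y * (S\<^sup>2 + y0\<^sup>2 * L\<^sup>2))" .
    have "y0 * m = 2 * S * (y0 * (\<xi> - Y\<^sup>2)) + 2 * Y * (y0\<^sup>2 * L\<^sup>2)"
      unfolding m_def by (simp add: power2_eq_square algebra_simps)
    moreover have "2 * S * (Y * S) \<le> 2 * S * (y0 * (\<xi> - Y\<^sup>2))"
      using cr S by (intro mult_left_mono) auto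
    moreover have "0 \<le> Y * S\<^sup>2" "0 \<le> Y * (y0\<^sup>2 * L\<^sup>2)" using Y by auto
    ultimately have "0 \<le> y0 * m - Y * (S\<^sup>2 + y0\<^sup>2 * L\<^sup>2)"
      by (simp add: power2_eq_square algebra_simps)
    then have "0 \<le> 4 * (A * B) * Y * c * (y0 * m - Y * (S\<^sup>2 + y0\<^sup>2 * L\<^sup>2))"
      using A B Y c by (intro mult_nonneg_nonneg) auto
    then show ?thesis using id by linarith
  qed
  have "\<alpha>\<^sup>2 * X = S\<^sup>2 * (4 * Y\<^sup>2 * (A * B) + 4 * (c * (\<xi> - Y\<^sup>2) - y0 * Y * S)\<^sup>2) / (c * P * A * B)\<^sup>2"
    unfolding \<alpha>2 X by (simp add: power2_eq_square)
  also have "\<dots> \<le> c\<^sup>2 * m\<^sup>2 / (c * P * A * B)\<^sup>2" using key by (intro divide_right_mono) auto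
  also have "\<dots> = M\<^sup>2" unfolding M using c by (simp add: power_divide power_mult_distrib)
  finally have "\<alpha>\<^sup>2 * X \<le> M\<^sup>2" .
  moreover have "0 \<le> M" unfolding M using m0 P A B by simp
  ultimately show ?thesis
    using chord_approximation[OF norm_hat norm_hat norm_hat _ d0 d1 M_def _ \<alpha>0 \<alpha>d] 
    unfolding X_def d_def dist_norm by blast
qed

section \<open>Cells\<close>

lemma convex_hull_rectangle:
  fixes x0 x1 y0 y1 :: real
  assumes "x0 \<le> x1" "y0 \<le> y1"
  shows "convex hull {(x0, y0), (x1, y0), (x1, y1), (x0, y1)} = {x0..x1} \<times> {y0..y1}"
proof -
  have *: "{(x0, y0), (x1, y0), (x1, y1), (x0, y1)} = {x0, x1} \<times> {y0, y1}" by auto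
  show ?thesis
    unfolding * convex_hull_Times using assms by (simp add: closed_segment_eq_real_ivl flip: segment_convex_hull)
qed

lemma convex_hull_horizontal:
  fixes x0 x1 :: real
  assumes "x0 \<le> x1"
  shows "convex hull {(x0, y), (x1, y)} = {x0..x1} \<times> {y :: real}"
proof -
  have *: "{(x0, y), (x1, y)} = {x0, x1} \<times> {y}" by auto
  show ?thesis
    unfolding * convex_hull_Times using assms by (simp add: closed_segment_eq_real_ivl flip: segment_convex_hull)
qed

text \<open>\<open>ARG_MIN\<close> selects some minimiser by choice, so the disk is determined only
  once the minimiser is known to be unique; hence \<open>min\<close> also fixes the centre.\<close>

lemma disk_eqI:
  assumes r: "0 \<le> r" "verts Q \<subseteq> sphere c r"
    and min: "\<And>c' r'. 0 \<le> r' \<Longrightarrow> verts Q \<subseteq> sphere c' r' \<Longrightarrow> r \<le> r' \<and> (r' = r \<longrightarrow> c' = c)"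
  shows "disk Q = cball c r"
proof -
  define P where "P cr = (snd cr \<ge> 0 \<and> verts Q \<subseteq> sphere (fst cr) (snd cr))" for cr
  have P: "P (c, r)" using r by (simp add: P_def)
  have least: "r \<le> snd cr" if "P cr" for cr
    using min[of "snd cr" "fst cr"] that unfolding P_def by blast
  have "is_arg_min snd P (c, r)"
    unfolding is_arg_min_def using P least by (metis snd_conv not_less)
  then have am: "is_arg_min snd P (arg_min snd P)"
    unfolding arg_min_def by (rule someI)
  obtain c' r' where cr: "arg_min snd P = (c', r')" by (cases "arg_min snd P")
  have P': "P (c', r')" and "\<not> r < r'"
    using am P unfolding is_arg_min_def cr by (metis, metis snd_conv)
  then have "r' = r" using least[OF P'] by simp
  then have "arg_min snd P = (c, r)"
    using min[of r' c'] P' unfolding P_def cr by (metis fst_conv snd_conv)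
  then show ?thesis unfolding disk_def P_def[symmetric] by simp
qed

lemma verts_Sq: "verts (Sq n i j) = {(dy n i, dy n j), (dy n (Suc i), dy n j),
    (dy n (Suc i), dy n (Suc j)), (dy n i, dy n (Suc j))}"
proof -
  have "{0..<4} = {0, 1, 2, 3 :: nat}" by auto
  then show ?thesis by (auto simp: sq_corner_def)
qed

lemma finite_verts [simp]: "finite (verts Q)"
  by (cases Q) auto

text \<open>A circle through both endpoints has its centre on the perpendicular bisector, and moving
  the centre off the axis by \<open>b\<close> adds \<open>b^2\<close> to the squared radius.\<close>

lemma disk_Seg:
  assumes "verts Q = {(x0, 0), (x1, 0)}" "x0 < x1"
  shows "disk Q = cball ((x0 + x1) / 2, 0) ((x1 - x0) / 2)"
proof (rule disk_eqI)
  show "0 \<le> (x1 - x0) / 2" using assms by simp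
  show "verts Q \<subseteq> sphere ((x0 + x1) / 2, 0) ((x1 - x0) / 2)"
  proof -
    have "\<bar>(x0 + x1) / 2 - x0\<bar> = (x1 - x0) / 2" "\<bar>(x0 + x1) / 2 - x1\<bar> = (x1 - x0) / 2"
      using assms(2) by (auto simp: abs_if field_simps)
    then show ?thesis unfolding assms(1) by (simp add: dist_norm norm_Pair del: abs_divide)
  qed
  fix c' :: pt2 and r' :: real
  assume r': "0 \<le> r'" and sub: "verts Q \<subseteq> sphere c' r'"
  obtain a b where c': "c' = (a, b)" by (cases c')
  have "(a - x)\<^sup>2 + b\<^sup>2 = r'\<^sup>2" if "(x, 0) \<in> verts Q" for x
  proof -
    have "norm (a - x, b) = r'" using sub that by (auto simp: c' dist_norm)
    moreover have "(norm (a - x, b))\<^sup>2 = (a - x)\<^sup>2 + b\<^sup>2" by (simp add: norm_Pair)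
    ultimately show ?thesis by simp
  qed
  then have e: "(a - x0)\<^sup>2 + b\<^sup>2 = r'\<^sup>2" "(a - x1)\<^sup>2 + b\<^sup>2 = r'\<^sup>2"
    unfolding assms(1) by blast+
  have "(x1 - x0) * (2 * a - x0 - x1) = (a - x0)\<^sup>2 - (a - x1)\<^sup>2"
    by (simp add: power2_eq_square algebra_simps)
  then have "(x1 - x0) * (2 * a - x0 - x1) = 0" using e by linarith
  then have a: "a = (x0 + x1) / 2" using assms(2) by simp
  have r2: "((x1 - x0) / 2)\<^sup>2 + b\<^sup>2 = r'\<^sup>2"
  proof -
    have "a - x0 = (x1 - x0) / 2" unfolding a by (simp add: field_simps)
    then show ?thesis using e(1) by (simp only:)
  qed
  moreover have "0 \<le> b\<^sup>2" by simp
  ultimately have "((x1 - x0) / 2)\<^sup>2 \<le> r'\<^sup>2" by linarith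
  then have "(x1 - x0) / 2 \<le> r'" using r' by (rule power2_le_imp_le)
  moreover have "b = 0" if "r' = (x1 - x0) / 2"
    using r2 unfolding that[symmetric] by simp
  ultimately show "(x1 - x0) / 2 \<le> r' \<and> (r' = (x1 - x0) / 2 \<longrightarrow> c' = ((x0 + x1) / 2, 0))"
    using a c' by simp
qed

text \<open>Three corners already determine centre and radius, so there is only one circle to
  consider.\<close>

lemma disk_Sq:
  assumes Q: "verts Q = {(x0, y0), (x1, y0), (x1, y1), (x0, y1)}" and x: "x0 < x1" "y0 < y1"
    and r: "r = sqrt (((x1 - x0) / 2)\<^sup>2 + ((y1 - y0) / 2)\<^sup>2)"
  shows "disk Q = cball ((x0 + x1) / 2, (y0 + y1) / 2) r"
proof (rule disk_eqI)
  show "0 \<le> r" using r by simp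
  have half: "((a + b) / 2 - a) = (b - a) / 2" "((a + b) / 2 - b) = - ((b - a) / 2)" for a b :: real
    by (simp_all add: field_simps)
  show "verts Q \<subseteq> sphere ((x0 + x1) / 2, (y0 + y1) / 2) r"
  proof -
    have ds: "dist (s, t) (s', t') = sqrt ((s - s')\<^sup>2 + (t - t')\<^sup>2)" for s t s' t' :: real
      by (simp add: dist_norm norm_Pair)
    show ?thesis unfolding Q r insert_subset mem_sphere ds half power2_minus by simp
  qed
  fix c' :: pt2 and r' :: real
  assume r': "0 \<le> r'" and sub: "verts Q \<subseteq> sphere c' r'"
  obtain a b where c': "c' = (a, b)" by (cases c')
  have e: "(a - x)\<^sup>2 + (b - y)\<^sup>2 = r'\<^sup>2" if "(x, y) \<in> verts Q" for x y
  proof -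
    have "norm (a - x, b - y) = r'" using sub that by (auto simp: c' dist_norm)
    moreover have "(norm (a - x, b - y))\<^sup>2 = (a - x)\<^sup>2 + (b - y)\<^sup>2" by (simp add: norm_Pair)
    ultimately show ?thesis by simp
  qed
  have e1: "(a - x0)\<^sup>2 + (b - y0)\<^sup>2 = r'\<^sup>2" "(a - x1)\<^sup>2 + (b - y0)\<^sup>2 = r'\<^sup>2" "(a - x0)\<^sup>2 + (b - y1)\<^sup>2 = r'\<^sup>2"
    by (rule e, simp add: Q)+
  have "(x1 - x0) * (2 * a - x0 - x1) = (a - x0)\<^sup>2 - (a - x1)\<^sup>2"
    by (simp add: power2_eq_square algebra_simps)
  then have "(x1 - x0) * (2 * a - x0 - x1) = 0" using e1 by linarith
  then have a: "a = (x0 + x1) / 2" using x by simp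
  have "(y1 - y0) * (2 * b - y0 - y1) = (b - y0)\<^sup>2 - (b - y1)\<^sup>2"
    by (simp add: power2_eq_square algebra_simps)
  then have "(y1 - y0) * (2 * b - y0 - y1) = 0" using e1 by linarith
  then have b: "b = (y0 + y1) / 2" using x by simp
  have "r'\<^sup>2 = ((x1 - x0) / 2)\<^sup>2 + ((y1 - y0) / 2)\<^sup>2"
    using e1(1) unfolding a b half by simp
  then have "r' = r" using r r' by (simp add: real_sqrt_unique)
  then show "r \<le> r' \<and> (r' = r \<longrightarrow> c' = ((x0 + x1) / 2, (y0 + y1) / 2))"
    using a b c' by simp
qed

section \<open>Distance from \<open>hat p\<close> to the convex hull of the vertex images\<close>

lemma segment_approximation:
  assumes "is_dyadic_segment Q" "p \<in> convex hull (verts Q)"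
  shows "\<exists>z \<in> convex hull (hat ` verts Q). norm (hat p - z) \<le> delta Q"
proof -
  obtain n j where Q: "Q = Seg n j" using assms by (auto simp: is_dyadic_segment_def)
  define x0 where "x0 = 4 * real j / 2 ^ n"
  define x1 where "x1 = 4 * real (Suc j) / 2 ^ n"
  have x0: "0 \<le> x0" unfolding x0_def by simp
  have x01: "x0 < x1" unfolding x0_def x1_def by (simp add: divide_strict_right_mono)
  have V: "verts Q = {(x0, 0), (x1, 0)}" by (simp add: Q x0_def x1_def)
  obtain x where p: "p = (x, 0)" and x: "x0 \<le> x" "x \<le> x1"
    using assms(2) x01 unfolding V by (subst (asm) convex_hull_horizontal) auto
  define c :: pt2 where "c = ((x0 + x1) / 2, 0)"
  define r where "r = (x1 - x0) / 2"
  define K where "K = x0 * x1"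
  define E where "E = (x - x0) * (x1 - x)"
  have d2: "d2 Q = diameter (hat ` cball c r)"
    unfolding d2_def disk_Seg[OF V x01] c_def r_def ..
  have Kr: "K = c \<bullet> c - r\<^sup>2" "r\<^sup>2 = c \<bullet> c - K"
    unfolding K_def c_def r_def by (simp_all add: power2_eq_square field_simps)
  have "r \<ge> 0" unfolding r_def using x01 by simp
  note d = diameter_hat_cball[OF this, of c, folded d2]
  define \<kappa> where "\<kappa> = (1 + K) / (1 + K + E)"
  have K0: "K \<ge> 0" unfolding K_def using x0 x01 by simp
  have E0: "E \<ge> 0" unfolding E_def using x by simp
  \<comment> \<open>The axis maps into a great circle, so the ray through \<open>hat p\<close>
    always meets the chord. In coordinates, shrinking by \<open>\<kappa>\<close> does not leave the
    segment at its left end because \<open>x0 \<ge> 0\<close>.\<close>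
  have "x0 \<le> \<kappa> * x"
  proof -
    have "(1 + K) * x - x0 * (1 + K + E) = (x - x0) * (1 + x0 * x)"
      unfolding K_def E_def by (simp add: algebra_simps)
    moreover have "0 \<le> (x - x0) * (1 + x0 * x)" using x x0 by simp
    ultimately show ?thesis unfolding \<kappa>_def using K0 E0 by (simp add: field_simps)
  qed
  moreover have "\<kappa> * x \<le> x"
    using K0 E0 x x0 unfolding \<kappa>_def by (intro mult_left_le_one_le) auto
  ultimately have "\<kappa> *\<^sub>R p \<in> convex hull (verts Q)"
    unfolding V p using x x01 by (subst convex_hull_horizontal) auto
  then have "\<exists>z \<in> convex hull (hat ` verts Q). norm (hat p - z) \<le> chi 2 (d2 Q)"
    unfolding \<kappa>_def
  proof (rule radial_approximation[rotated 4])
    show "\<And>q. q \<in> verts Q \<Longrightarrow> q \<bullet> q = 2 * (c \<bullet> q) - K"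
      unfolding V c_def K_def by (auto simp: algebra_simps)
    show "E = 2 * (c \<bullet> p) - K - p \<bullet> p"
      unfolding p c_def K_def E_def by (simp add: algebra_simps)
  qed (use K0 E0 d(1) d(2)[folded Kr(1), unfolded Kr(2)] in auto)
  then show ?thesis by (simp add: Q)
qed

lemma rectangle_approximation:
  fixes x0 x1 y0 y1 :: real
  defines "V \<equiv> {(x0, y0), (x1, y0), (x1, y1), (x0, y1)}"
  assumes x: "x0 < x1" "x1 - x0 \<le> 1/2" "- (3/2) \<le> x0" "x1 \<le> 3/2"
    and y: "y0 < y1" "y1 - y0 \<le> 1/2" "- (3/2) \<le> y0" "y1 \<le> 3/2"
    and c: "c = ((x0 + x1) / 2, (y0 + y1) / 2)"
    and r: "r = sqrt (((x1 - x0) / 2)\<^sup>2 + ((y1 - y0) / 2)\<^sup>2)"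
    and d: "dist (hat (x0, y0)) (hat (x1, y0)) \<le> d" "dist (hat (x1, y0)) (hat (x1, y1)) \<le> d"
      "dist (hat (x1, y1)) (hat (x0, y1)) \<le> d" "dist (hat (x0, y1)) (hat (x0, y0)) \<le> d"
    and p: "p \<in> convex hull V"
  shows "\<exists>z \<in> convex hull (hat ` V).
    norm (hat p - z) \<le> max (chi 1 d) (chi 2 (diameter (hat ` cball c r)))"
proof -
  obtain px py where pe: "p = (px, py)" and pb: "x0 \<le> px" "px \<le> x1" "y0 \<le> py" "py \<le> y1"
    using p x y unfolding V_def by (subst (asm) convex_hull_rectangle) auto
  define K where "K = x0 * x1 + y0 * y1"
  define Ex where "Ex = (px - x0) * (x1 - px)"
  define Ey where "Ey = (py - y0) * (y1 - py)"
  define E where "E = Ex + Ey"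
  define \<kappa> where "\<kappa> = (1 + K) / (1 + K + E)"
  have E0: "E \<ge> 0" unfolding E_def Ex_def Ey_def using pb by simp
  \<comment> \<open>Here side length at most 1/2 enters: it gives \<open>K \<ge> - 1/8\<close>, well
    above the bound -1 needed for positive denominators.\<close>
  have prod: "- (1/16) \<le> a * b" if "a < b" "b - a \<le> 1/2" for a b :: real
  proof -
    have "(b - a)\<^sup>2 \<le> (1/2)\<^sup>2" using that by (intro power_mono) auto
    moreover have "4 * (a * b) = (a + b)\<^sup>2 - (b - a)\<^sup>2"
      by (simp add: power2_eq_square algebra_simps)
    moreover have "0 \<le> (a + b)\<^sup>2" "(1/2 :: real)\<^sup>2 = 1/4" by (simp_all add: power2_eq_square)
    ultimately show ?thesis by linarith
  qed
  have K0: "K > -1" unfolding K_def using prod[OF x(1,2)] prod[OF y(1,2)] by linarith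
  have \<kappa>: "0 < \<kappa>" "\<kappa> \<le> 1" unfolding \<kappa>_def using K0 E0 by auto
  have r0: "r \<ge> 0" using r by simp
  have Kr: "K = c \<bullet> c - r\<^sup>2" "r\<^sup>2 = c \<bullet> c - K"
  proof -
    have "r\<^sup>2 = ((x1 - x0) / 2)\<^sup>2 + ((y1 - y0) / 2)\<^sup>2" unfolding r by simp
    then show "K = c \<bullet> c - r\<^sup>2" "r\<^sup>2 = c \<bullet> c - K"
      unfolding K_def c by (simp_all add: power2_eq_square field_simps)
  qed
  note dd = diameter_hat_cball[OF r0, of c]
  have edge: ?thesis
    if ab: "a \<in> V" "b \<in> V" and dab: "dist (hat a) (hat b) \<le> d"
      and z: "\<exists>z \<in> closed_segment (hat a) (hat b). norm (hat p - z) \<le> chi 1 (dist (hat a) (hat b))"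
    for a b
  proof -
    obtain z where z: "z \<in> closed_segment (hat a) (hat b)" "norm (hat p - z) \<le> chi 1 (dist (hat a) (hat b))"
      using z by blast
    have "closed_segment (hat a) (hat b) \<subseteq> convex hull (hat ` V)"
      using ab by (auto simp: segment_convex_hull intro!: hull_mono)
    moreover have "chi 1 (dist (hat a) (hat b)) \<le> chi 1 d" using dab by (intro chi_mono) auto
    ultimately show ?thesis using z by (intro bexI[of _ z]) auto
  qed
  text \<open>If shrinking \<open>p\<close> by \<open>\<kappa>\<close> leaves the square across a side, that side separates the origin
    from the square, and \<open>hat p\<close> lies outside the cone over the convex hull of \<open>hat ` V\<close>.\<close>
  have low: "0 < l" if "l \<le> t" "\<kappa> * t < l" for l t :: real
  proof (rule ccontr)
    assume "\<not> 0 < l"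
    moreover have "t * \<kappa> \<ge> t" if "t \<le> 0" using mult_left_mono_neg[OF \<kappa>(2) that] by simp
    moreover have "\<kappa> * t \<ge> 0" if "t \<ge> 0" using that \<kappa> by simp
    ultimately show False using that by (smt (verit) mult.commute)
  qed
  have cut: "(1 + K) * t < l * (1 + K + E)" if "\<kappa> * t < l" for l t :: real
  proof -
    have "1 + K + E > 0" using K0 E0 by simp
    moreover have "(1 + K) * t / (1 + K + E) < l" using that unfolding \<kappa>_def by simp
    ultimately show ?thesis by (simp add: divide_less_eq)
  qed
  \<comment> \<open>The upper sides are stated with negated coordinates, so that \<open>low\<close>
    and \<open>cut\<close> cover all four sides and each case reduces to
    \<open>edge_approximation\<close> by a reflection or a swap of coordinates.\<close>
  consider "\<kappa> * py < y0" | "\<kappa> * (- py) < - y1" | "\<kappa> * px < x0" | "\<kappa> * (- px) < - x1"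
    | "x0 \<le> \<kappa> * px \<and> \<kappa> * px \<le> x1 \<and> y0 \<le> \<kappa> * py \<and> \<kappa> * py \<le> y1"
    by (metis linorder_not_le mult_minus_right neg_less_iff_less)
  then show ?thesis
  proof cases
    case 1
    show ?thesis
    proof (rule edge[of "(x0, y0)" "(x1, y0)"])
      show "\<exists>z\<in>closed_segment (hat (x0, y0)) (hat (x1, y0)).
          norm (hat p - z) \<le> chi 1 (dist (hat (x0, y0)) (hat (x1, y0)))"
      proof (rule edge_approximation[of _ x0 y0 _ x1 _ px py])
        \<comment> \<open>In \<open>cut\<close>, moving the term \<open>y0 * Ey\<close> to the left
          turns the \<open>y1\<close> inside \<open>K\<close> into \<open>py\<close>, which gives
          exactly \<open>cross\<close>.\<close>
        show "(py - y0) * (1 + x0 * x1 + py * y0) \<le> y0 * ((px - x0) * (x1 - px))"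
          using cut[OF 1] unfolding K_def E_def Ex_def Ey_def by (simp add: algebra_simps)
      qed (use x y pb low[OF _ 1] in \<open>simp_all add: pe power2_eq_square\<close>)
    qed (use d in \<open>auto simp: V_def\<close>)
  next
    case 2
    show ?thesis
    proof (rule edge[of "(x0, y1)" "(x1, y1)"])
      show "\<exists>z\<in>closed_segment (hat (x0, y1)) (hat (x1, y1)).
          norm (hat p - z) \<le> chi 1 (dist (hat (x0, y1)) (hat (x1, y1)))"
      proof (rule edge_approximation[of _ x0 "- y1" _ x1 _ px "- py"])
        show "(- py - - y1) * (1 + x0 * x1 + - py * - y1) \<le> - y1 * ((px - x0) * (x1 - px))"
          using cut[OF 2] unfolding K_def E_def Ex_def Ey_def by (simp add: algebra_simps)
      qed (use x y pb low[OF _ 2] in \<open>simp_all add: pe power2_eq_square\<close>)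
    qed (use d in \<open>auto simp: V_def dist_commute\<close>)
  next
    case 3
    show ?thesis
    proof (rule edge[of "(x0, y0)" "(x0, y1)"])
      show "\<exists>z\<in>closed_segment (hat (x0, y0)) (hat (x0, y1)).
          norm (hat p - z) \<le> chi 1 (dist (hat (x0, y0)) (hat (x0, y1)))"
      proof (rule edge_approximation[of _ y0 x0 _ y1 _ py px])
        show "(px - x0) * (1 + y0 * y1 + px * x0) \<le> x0 * ((py - y0) * (y1 - py))"
          using cut[OF 3] unfolding K_def E_def Ex_def Ey_def by (simp add: algebra_simps)
      qed (use x y pb low[OF _ 3] in \<open>simp_all add: pe power2_eq_square\<close>)
    qed (use d in \<open>auto simp: V_def dist_commute\<close>)
  next
    case 4
    show ?thesis
    proof (rule edge[of "(x1, y0)" "(x1, y1)"])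
      show "\<exists>z\<in>closed_segment (hat (x1, y0)) (hat (x1, y1)).
          norm (hat p - z) \<le> chi 1 (dist (hat (x1, y0)) (hat (x1, y1)))"
      proof (rule edge_approximation[of _ y0 "- x1" _ y1 _ py "- px"])
        show "(- px - - x1) * (1 + y0 * y1 + - px * - x1) \<le> - x1 * ((py - y0) * (y1 - py))"
          using cut[OF 4] unfolding K_def E_def Ex_def Ey_def by (simp add: algebra_simps)
      qed (use x y pb low[OF _ 4] in \<open>simp_all add: pe power2_eq_square\<close>)
    qed (use d in \<open>auto simp: V_def dist_commute\<close>)
  next
    case 5
    then have "\<kappa> *\<^sub>R p \<in> convex hull V"
      unfolding V_def pe using x y by (subst convex_hull_rectangle) auto
    then have "\<exists>z \<in> convex hull (hat ` V). norm (hat p - z) \<le> chi 2 (diameter (hat ` cball c r))"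
      unfolding \<kappa>_def
    proof (rule radial_approximation[rotated 4])
      show "\<And>q. q \<in> V \<Longrightarrow> q \<bullet> q = 2 * (c \<bullet> q) - K"
        unfolding V_def c K_def by (auto simp: field_simps)
      show "E = 2 * (c \<bullet> p) - K - p \<bullet> p"
        unfolding pe c K_def E_def Ex_def Ey_def by (simp add: field_simps)
    qed (use K0 E0 dd(1) dd(2)[folded Kr(1), unfolded Kr(2)] in auto)
    then show ?thesis by (meson max.coboundedI2)
  qed
qed

lemma square_approximation:
  assumes "good_square Q" "p \<in> convex hull (verts Q)"
  shows "\<exists>z \<in> convex hull (hat ` verts Q). norm (hat p - z) \<le> delta Q"
proof -
  obtain n i j where Q: "Q = Sq n i j" and
    sub: "convex hull (verts Q) \<subseteq> {p. \<bar>fst p\<bar> \<le> 3/2 \<and> \<bar>snd p\<bar> \<le> 3/2}" and n: "4 / 2 ^ n \<le> (1/2 :: real)"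
    using assms by (auto simp: good_square_def)
  define x0 where "x0 = dy n i"
  define x1 where "x1 = dy n (Suc i)"
  define y0 where "y0 = dy n j"
  define y1 where "y1 = dy n (Suc j)"
  have step: "dy n (Suc m) - dy n m = 4 / 2 ^ n" for m
    by (simp add: dy_def add_divide_distrib distrib_left)
  have pos: "0 < (4 / 2 ^ n :: real)" by simp
  have V: "verts Q = {(x0, y0), (x1, y0), (x1, y1), (x0, y1)}"
    unfolding Q verts_Sq x0_def x1_def y0_def y1_def ..
  have x: "x0 < x1" "x1 - x0 \<le> 1/2" and y: "y0 < y1" "y1 - y0 \<le> 1/2"
    using step[of i] step[of j] pos n unfolding x0_def x1_def y0_def y1_def by linarith+
  have "(x0, y0) \<in> convex hull (verts Q)" "(x1, y1) \<in> convex hull (verts Q)"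
    by (auto simp: V intro!: hull_inc)
  then have b: "- (3/2) \<le> x0" "x1 \<le> 3/2" "- (3/2) \<le> y0" "y1 \<le> 3/2"
    using sub by (auto simp: abs_le_iff)
  define r where "r = sqrt (((x1 - x0) / 2)\<^sup>2 + ((y1 - y0) / 2)\<^sup>2)"
  define c where "c = ((x0 + x1) / 2, (y0 + y1) / 2)"
  have d2: "d2 Q = diameter (hat ` cball c r)"
    unfolding d2_def disk_Sq[OF V x(1) y(1) r_def] c_def ..
  \<comment> \<open>Corner indices are read modulo 4, so \<open>m = 3\<close> gives the side that
    closes the square.\<close>
  have "dist (hat (sq_corner n i j m)) (hat (sq_corner n i j (Suc m))) \<le> d1 Q" if "m < 4" for m
    using that by (auto simp: Q d1_def intro!: Max_ge)
  from this[of 0] this[of 1] this[of 2] this[of 3]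
  have d: "dist (hat (x0, y0)) (hat (x1, y0)) \<le> d1 Q" "dist (hat (x1, y0)) (hat (x1, y1)) \<le> d1 Q"
      "dist (hat (x1, y1)) (hat (x0, y1)) \<le> d1 Q" "dist (hat (x0, y1)) (hat (x0, y0)) \<le> d1 Q"
    by (simp_all add: sq_corner_def x0_def x1_def y0_def y1_def)
  have "delta Q = max (chi 1 (d1 Q)) (chi 2 (diameter (hat ` cball c r)))"
    by (simp add: Q flip: d2)
  then show ?thesis
    using rectangle_approximation[OF x b(1,2) y b(3,4) c_def r_def d] assms(2) unfolding V by simp
qed

section \<open>Energies\<close>

definition good_cell :: "cell \<Rightarrow> bool" where
  "good_cell Q \<longleftrightarrow> is_dyadic_segment Q \<or> good_square Q"

lemma good_cell_not_Infty: "good_cell Q \<Longrightarrow> Q \<noteq> Infty"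
  by (auto simp: good_cell_def is_dyadic_segment_def good_square_def)

lemma good_cell_vhat: "good_cell Q \<Longrightarrow> vhat Q = hat ` verts Q"
  by (simp add: vhat_def good_cell_not_Infty)

lemma finite_vhat [simp]: "finite (vhat Q)"
  by (simp add: vhat_def)

lemma norm_vhat: "u \<in> vhat Q \<Longrightarrow> norm u = 1"
  by (auto simp: vhat_def split: if_splits)

lemma norm_convex_hull_vhat: "z \<in> convex hull (vhat Q) \<Longrightarrow> norm z \<le> 1"
proof -
  have "convex hull (vhat Q) \<subseteq> cball 0 1" by (intro hull_minimal) (auto simp: norm_vhat)
  then show "z \<in> convex hull (vhat Q) \<Longrightarrow> norm z \<le> 1" by auto
qed

lemma delta_nonneg: "0 \<le> delta Q"
  by (cases Q) (auto simp: chi_nonneg le_max_iff_disj)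

lemma good_cell_approximation:
  assumes "good_cell Q" "p \<in> convex hull (verts Q)"
  shows "\<exists>z \<in> convex hull (vhat Q). norm (hat p - z) \<le> delta Q"
  using assms segment_approximation square_approximation
  unfolding good_cell_vhat[OF assms(1)] by (metis good_cell_def)

lemma inner_convex_hull_le:
  fixes v :: "'a :: real_inner"
  assumes "\<And>u. u \<in> S \<Longrightarrow> u \<bullet> v \<le> b" "z \<in> convex hull S"
  shows "z \<bullet> v \<le> b"
proof -
  have "convex {x. v \<bullet> x \<le> b}" by (rule convex_halfspace_le)
  then have "convex hull S \<subseteq> {x. v \<bullet> x \<le> b}"
    using assms(1) by (intro hull_minimal) (auto simp: inner_commute)
  then show ?thesis using assms(2) by (auto simp: inner_commute)
qed

text \<open>Against \<open>Infty\<close>, \<open>dotmax\<close> has no \<open>delta\<close> term to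
  absorb an approximation error, so an exact argument is needed: the height of \<open>hat p\<close>
  increases with \<open>norm p\<close>, and the norm on a convex hull is largest at a
  vertex.\<close>

lemma height_le_vertex:
  assumes p: "p \<in> convex hull (verts Q)" and b: "\<And>q. q \<in> verts Q \<Longrightarrow> hat q \<bullet> north \<le> b"
  shows "hat p \<bullet> north \<le> b"
proof -
  define R where "R = Max (norm ` verts Q)"
  have ne: "verts Q \<noteq> {}" using p by auto
  have "verts Q \<subseteq> cball 0 R" by (auto simp: R_def)
  then have "convex hull (verts Q) \<subseteq> cball 0 R" by (intro hull_minimal) auto
  then have pR: "norm p \<le> R" using p by auto
  have "R \<in> norm ` verts Q" unfolding R_def using ne by (intro Max_in) auto
  then obtain q where q: "q \<in> verts Q" "R = norm q" by auto
  have le: "p \<bullet> p \<le> q \<bullet> q"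
    using pR q by (metis norm_le)
  have form: "hat x \<bullet> north = 1 - 2 / (1 + x \<bullet> x)" for x
    using one_plus_inner_pos[of x] by (simp add: inner_hat_north field_simps)
  have "hat p \<bullet> north \<le> hat q \<bullet> north"
    unfolding form using le one_plus_inner_pos[of p] one_plus_inner_pos[of q]
    by (simp add: frac_le)
  then show ?thesis using b[OF q(1)] by linarith
qed

text \<open>This lets infinity act as a partner point on the same footing as the four finite
  points.\<close>

definition in_cell :: "cell \<Rightarrow> pt2 option \<Rightarrow> bool" where
  "in_cell Q q = (case q of None \<Rightarrow> Q = Infty | Some p \<Rightarrow> good_cell Q \<and> p \<in> convex hull (verts Q))"

lemma norm_hatx: "norm (hatx q) = 1"
  by (cases q) (auto simp: hatx_def)

text \<open>For finite partners, write each point as a hull point of norm at most 1 plus an error of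
  norm at most \<open>delta\<close>, and expand the inner product: the four terms match the four
  summands of \<open>dotmax\<close>. A vertex is the case of zero error.\<close>

lemma inner_le_dotmax:
  assumes Q: "good_cell Q" and q: "in_cell Q' q"
  shows "u \<in> vhat Q \<Longrightarrow> u \<bullet> hatx q \<le> dotmax Q Q'"
    and "p \<in> convex hull (verts Q) \<Longrightarrow> hat p \<bullet> hatx q \<le> dotmax Q Q'"
proof -
  have 1: "(\<forall>u \<in> vhat Q. u \<bullet> hatx q \<le> dotmax Q Q') \<and>
     (\<forall>p \<in> convex hull (verts Q). hat p \<bullet> hatx q \<le> dotmax Q Q')"
  proof (cases q)
    case None
    then have Q': "Q' = Infty" using q by (simp add: in_cell_def)
    have le: "u \<bullet> north \<le> dotmax Q Q'" if "u \<in> vhat Q" for u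
    proof -
      have "{u \<bullet> north | u. u \<in> vhat Q} = (\<lambda>u. u \<bullet> north) ` vhat Q" by auto
      then show ?thesis using that by (simp add: dotmax_def Q')
    qed
    then have "hat p \<bullet> north \<le> dotmax Q Q'" if "p \<in> convex hull (verts Q)" for p
      using that height_le_vertex[OF that] by (simp add: good_cell_vhat[OF Q])
    then show ?thesis using le by (simp add: None hatx_def)
  next
    case (Some p')
    then have Q': "good_cell Q'" and p': "p' \<in> convex hull (verts Q')"
      using q by (auto simp: in_cell_def)
    define m where "m = Max {u \<bullet> v | u v. u \<in> vhat Q \<and> v \<in> vhat Q'}"
    have dm: "dotmax Q Q' = m + delta Q + delta Q' + delta Q * delta Q'"
      using good_cell_not_Infty[OF Q'] by (simp add: dotmax_def m_def)
    have vm: "u \<bullet> v \<le> m" if "u \<in> vhat Q" "v \<in> vhat Q'" for u v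
    proof -
      have "finite {u \<bullet> v | u v. u \<in> vhat Q \<and> v \<in> vhat Q'}"
        by (rule finite_image_set2) simp_all
      then show ?thesis unfolding m_def using that by (intro Max_ge) blast+
    qed
    have hm: "z \<bullet> v \<le> m" if "z \<in> convex hull (vhat Q)" "v \<in> convex hull (vhat Q')" for z v
    proof (rule inner_convex_hull_le[OF _ that(1)])
      fix u assume u: "u \<in> vhat Q"
      have "v \<bullet> u \<le> m" using vm[OF u] by (intro inner_convex_hull_le[OF _ that(2)]) (simp add: inner_commute)
      then show "u \<bullet> v \<le> m" by (simp add: inner_commute)
    qed
    obtain z' where z': "z' \<in> convex hull (vhat Q')" "norm (hat p' - z') \<le> delta Q'"
      using good_cell_approximation[OF Q' p'] by blast
    define e' where "e' = hat p' - z'"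
    have \<delta>: "0 \<le> delta Q" "0 \<le> delta Q'" by (rule delta_nonneg)+
    have bound: "(z + e) \<bullet> hat p' \<le> dotmax Q Q'"
      if z: "z \<in> convex hull (vhat Q)" and e: "norm e \<le> delta Q" for z e
    proof -
      have ip: "x \<bullet> y \<le> s * t" if "norm x \<le> s" "norm y \<le> t" for x y :: pt3 and s t
      proof -
        have "0 \<le> s" using that(1) norm_ge_zero order_trans by blast
        then have "norm x * norm y \<le> s * t" using that by (intro mult_mono) auto
        then show ?thesis using norm_cauchy_schwarz[of x y] by linarith
      qed
      have "(z + e) \<bullet> hat p' = z \<bullet> z' + z \<bullet> e' + e \<bullet> z' + e \<bullet> e'"
        by (simp add: e'_def inner_add_left inner_diff_right)
      moreover have "z \<bullet> z' \<le> m" using hm z z' by blast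
      moreover have "z \<bullet> e' \<le> 1 * delta Q'"
        using ip norm_convex_hull_vhat[OF z] z'(2) unfolding e'_def by blast
      moreover have "e \<bullet> z' \<le> delta Q * 1" using ip e norm_convex_hull_vhat[OF z'(1)] by blast
      moreover have "e \<bullet> e' \<le> delta Q * delta Q'" using ip e z'(2) unfolding e'_def by blast
      ultimately show ?thesis unfolding dm by linarith
    qed
    have "u \<bullet> hat p' \<le> dotmax Q Q'" if "u \<in> vhat Q" for u
      using bound[of u 0] that \<delta> by (simp add: hull_inc)
    moreover have "hat p \<bullet> hat p' \<le> dotmax Q Q'" if p: "p \<in> convex hull (verts Q)" for p
    proof -
      obtain z where "z \<in> convex hull (vhat Q)" "norm (hat p - z) \<le> delta Q"
        using good_cell_approximation[OF Q p] by blast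
      then show ?thesis using bound[of z "hat p - z"] by simp
    qed
    ultimately show ?thesis by (simp add: Some hatx_def)
  qed
  show "u \<in> vhat Q \<Longrightarrow> u \<bullet> hatx q \<le> dotmax Q Q'"
    and "p \<in> convex hull (verts Q) \<Longrightarrow> hat p \<bullet> hatx q \<le> dotmax Q Q'"
    using 1 by auto
qed

section \<open>Error estimate for one pair of points\<close>

lemma Gk_eq: "Gk k p q = (2 + 2 * (hatx p \<bullet> hatx q)) ^ k"
proof -
  have "hatx x \<bullet> hatx x = 1" for x using norm_hatx[of x] by (simp add: norm_eq_1)
  then show ?thesis
    by (simp add: Gk_def power2_norm_eq_inner inner_diff inner_commute)
qed

lemma Gk_commute: "Gk k p q = Gk k q p"
  by (simp add: Gk_def norm_minus_commute)

text \<open>The weights are those of the hull point near \<open>hat p\<close>, so they are fixed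
  before \<open>k\<close> and the partner. This is what allows the estimates to be summed over
  partners and over coefficients of either sign.\<close>

lemma vertex_mixture:
  assumes Q: "good_cell Q" and p: "p \<in> convex hull (verts Q)"
  obtains \<mu> where "\<And>q. q \<in> verts Q \<Longrightarrow> 0 \<le> \<mu> q" "sum \<mu> (verts Q) = 1"
    "\<And>k Q' q'. in_cell Q' q' \<Longrightarrow>
      \<bar>Gk k (Some p) q' - (\<Sum>q\<in>verts Q. \<mu> q * Gk k (Some q) q')\<bar> \<le> eps k Q Q'"
proof -
  obtain z where z: "z \<in> convex hull (hat ` verts Q)" "norm (hat p - z) \<le> delta Q"
    using good_cell_approximation[OF Q p] by (auto simp: good_cell_vhat[OF Q])
  \<comment> \<open>Injectivity transfers weights on the image points to weights on the vertices
    themselves.\<close>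
  have inj: "inj_on hat (verts Q)"
  proof (rule inj_onI)
    fix x y assume "hat x = hat y"
    then have "(dist (hat x) (hat y))\<^sup>2 = 0" by simp
    then show "x = y"
      unfolding dist_hat_square using one_plus_inner_pos[of x] one_plus_inner_pos[of y] by auto
  qed
  obtain \<nu> where \<nu>: "\<forall>u \<in> hat ` verts Q. 0 \<le> \<nu> u" "sum \<nu> (hat ` verts Q) = 1"
      "(\<Sum>u\<in>hat ` verts Q. \<nu> u *\<^sub>R u) = z"
    using z(1) unfolding convex_hull_finite[OF finite_imageI[OF finite_verts]] by blast
  define \<mu> where "\<mu> = \<nu> \<circ> hat"
  have sum1: "sum \<mu> (verts Q) = 1"
    using \<nu>(2) by (simp add: \<mu>_def sum.reindex[OF inj])
  have zsum: "z = (\<Sum>q\<in>verts Q. \<mu> q *\<^sub>R hat q)"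
    using \<nu>(3) by (simp add: \<mu>_def sum.reindex[OF inj])
  have nn: "0 \<le> \<mu> q" if "q \<in> verts Q" for q using that \<nu>(1) by (simp add: \<mu>_def)
  have "\<bar>Gk k (Some p) q' - (\<Sum>q\<in>verts Q. \<mu> q * Gk k (Some q) q')\<bar> \<le> eps k Q Q'"
    if q': "in_cell Q' q'" for k Q' q'
  proof -
    define V where "V = hatx q'"
    define T where "T = 2 + 2 * dotmax Q Q'"
    define X where "X q = 2 + 2 * (hat q \<bullet> V)" for q
    have V1: "norm V = 1" unfolding V_def by (rule norm_hatx)
    have X0: "0 \<le> X q" for q
      using Cauchy_Schwarz_ineq2[of "hat q" V] V1 unfolding X_def by simp
    have "X q \<le> T" if "q \<in> verts Q" for q
      using inner_le_dotmax(1)[OF Q q', of "hat q"] that unfolding X_def T_def V_def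
      by (simp add: good_cell_vhat[OF Q])
    moreover have "\<bar>X s - X t\<bar> \<le> 2 * dQ Q" if "s \<in> verts Q" "t \<in> verts Q" for s t
    proof -
      have "X s - X t = 2 * ((hat s - hat t) \<bullet> V)" by (simp add: X_def inner_diff_left)
      moreover have "\<bar>(hat s - hat t) \<bullet> V\<bar> \<le> dist (hat s) (hat t)"
        using Cauchy_Schwarz_ineq2[of "hat s - hat t" V] V1 by (simp add: dist_norm)
      moreover have "dist (hat s) (hat t) \<le> dQ Q"
      proof -
        have "bounded (convex hull (vhat Q))"
          by (intro bounded_convex_hull finite_imp_bounded) simp
        then show ?thesis unfolding dQ_def using that good_cell_not_Infty[OF Q]
          by (auto simp: good_cell_vhat[OF Q] intro!: diameter_bounded_bound hull_inc)
      qed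
      ultimately show ?thesis by (simp add: abs_mult)
    qed
    moreover have "X p \<le> T"
      using inner_le_dotmax(2)[OF Q q' p] unfolding X_def T_def V_def by simp
    moreover have "\<bar>X p - (\<Sum>q\<in>verts Q. \<mu> q * X q)\<bar> \<le> 2 * delta Q"
    proof -
      have "(\<Sum>q\<in>verts Q. \<mu> q * X q) = 2 * sum \<mu> (verts Q) + 2 * (z \<bullet> V)"
        unfolding zsum X_def by (simp add: inner_sum_left sum_distrib_left sum.distrib algebra_simps)
      then have "X p - (\<Sum>q\<in>verts Q. \<mu> q * X q) = 2 * ((hat p - z) \<bullet> V)"
        unfolding X_def sum1 by (simp add: inner_diff_left)
      moreover have "\<bar>(hat p - z) \<bullet> V\<bar> \<le> delta Q"
        using Cauchy_Schwarz_ineq2[of "hat p - z" V] V1 z(2) by simp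
      ultimately show ?thesis by (simp add: abs_mult)
    qed
    ultimately have "\<bar>X p ^ k - (\<Sum>q\<in>verts Q. \<mu> q * X q ^ k)\<bar>
        \<le> 1/2 * real k * (real k - 1) * T ^ (k - 2) * (dQ Q)\<^sup>2 + 2 * real k * T ^ (k - 1) * delta Q"
      using nn sum1 X0 by (intro power_mixture_error) auto
    also have "\<dots> = eps k Q Q'"
      using good_cell_not_Infty[OF Q] by (simp add: eps_def T_def Let_def)
    finally show ?thesis by (simp add: Gk_eq X_def V_def hatx_def)
  qed
  then show thesis using that[of \<mu>] nn sum1 by blast
qed

section \<open>Replacing the points of a configuration by vertices\<close>

lemma energy_update:
  assumes "i < 4"
  shows "energy k (p(i := q)) - energy k p =
    (\<Sum>j\<in>{..4} - {i}. Gk k (Some q) (cfg p j) - Gk k (Some (p i)) (cfg p j))"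
proof -
  have atMost4: "{..4} = {0, 1, 2, 3, 4 :: nat}" by auto
  have lessThan: "{..<0::nat} = {}" "{..<1::nat} = {0}" "{..<2::nat} = {0, 1}"
    "{..<3::nat} = {0, 1, 2}" "{..<4::nat} = {0, 1, 2, 3}" by auto
  consider "i = 0" | "i = 1" | "i = 2" | "i = 3" using assms by linarith
  then show ?thesis
    by cases (simp_all add: energy_def atMost4 lessThan cfg_def insert_Diff_if Gk_commute)
qed

lemma good_block_cell: "good_block Q \<Longrightarrow> i < 4 \<Longrightarrow> good_cell (Q i)"
proof -
  assume "good_block Q" "i < 4"
  moreover have "i = 0 \<or> i = 1 \<or> i = 2 \<or> i = 3" using \<open>i < 4\<close> by linarith
  ultimately show "good_cell (Q i)" by (auto simp: good_block_def good_cell_def)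
qed

text \<open>The change \<open>\<Phi>\<close> caused by putting a vertex in place of
  \<open>p i\<close>, averaged with the weights \<open>\<mu>\<close>, is at most the error sum. Only
  pairs containing \<open>i\<close> contribute, and the absolute values of the coefficients take
  care of signs.\<close>

lemma replace_by_vertex:
  fixes a :: "nat \<Rightarrow> real"
  assumes Q: "good_block Q" and p: "\<forall>j<4. p j \<in> convex hull (verts (Q j))" and i: "i < 4"
  shows "\<exists>q \<in> verts (Q i). (\<Sum>k=1..N. a k * energy k (p(i := q)))
    \<le> (\<Sum>k=1..N. a k * energy k p)
      + (\<Sum>k=1..N. \<bar>a k\<bar> * (\<Sum>j\<in>{..4} - {i}. eps k (blk Q i) (blk Q j)))"
proof -
  have Qi: "good_cell (Q i)" using good_block_cell[OF Q i] .
  have pi: "p i \<in> convex hull (verts (Q i))" using p i by blast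
  obtain \<mu> where nn: "\<And>q. q \<in> verts (Q i) \<Longrightarrow> 0 \<le> \<mu> q" and one: "sum \<mu> (verts (Q i)) = 1"
    and mix: "\<And>k Q' q'. in_cell Q' q' \<Longrightarrow>
      \<bar>Gk k (Some (p i)) q' - (\<Sum>q\<in>verts (Q i). \<mu> q * Gk k (Some q) q')\<bar> \<le> eps k (Q i) Q'"
    by (rule vertex_mixture[OF Qi pi]) (rule that)
  have cell: "in_cell (blk Q j) (cfg p j)" for j
    using p good_block_cell[OF Q] by (simp add: in_cell_def blk_def cfg_def)
  have blk: "blk Q i = Q i" using i by (simp add: blk_def)
  define \<Phi> where "\<Phi> q = (\<Sum>k=1..N. a k * (energy k (p(i := q)) - energy k p))" for q
  define err where "err = (\<Sum>k=1..N. \<bar>a k\<bar> * (\<Sum>j\<in>{..4} - {i}. eps k (blk Q i) (blk Q j)))"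
  have "(\<Sum>q\<in>verts (Q i). \<mu> q * \<Phi> q) = (\<Sum>k=1..N. a k * (\<Sum>j\<in>{..4} - {i}.
      (\<Sum>q\<in>verts (Q i). \<mu> q * (Gk k (Some q) (cfg p j) - Gk k (Some (p i)) (cfg p j)))))"
  proof -
    have "(\<Sum>q\<in>verts (Q i). \<mu> q * \<Phi> q) = (\<Sum>q\<in>verts (Q i). \<Sum>k=1..N. \<Sum>j\<in>{..4} - {i}.
        a k * (\<mu> q * (Gk k (Some q) (cfg p j) - Gk k (Some (p i)) (cfg p j))))"
      unfolding \<Phi>_def energy_update[OF i] by (simp add: sum_distrib_left mult.left_commute)
    also have "\<dots> = (\<Sum>k=1..N. \<Sum>j\<in>{..4} - {i}. \<Sum>q\<in>verts (Q i).
        a k * (\<mu> q * (Gk k (Some q) (cfg p j) - Gk k (Some (p i)) (cfg p j))))"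
      unfolding sum.swap[of _ _ "verts (Q i)"] ..
    finally show ?thesis by (simp add: sum_distrib_left)
  qed
  also have "\<dots> \<le> err"
    unfolding err_def
  proof (rule sum_mono)
    fix k
    define s where "s j = (\<Sum>q\<in>verts (Q i). \<mu> q * (Gk k (Some q) (cfg p j) - Gk k (Some (p i)) (cfg p j)))" for j
    have "\<bar>s j\<bar> \<le> eps k (blk Q i) (blk Q j)" for j
    proof -
      have "s j = (\<Sum>q\<in>verts (Q i). \<mu> q * Gk k (Some q) (cfg p j)) - Gk k (Some (p i)) (cfg p j)"
        unfolding s_def using one by (simp add: right_diff_distrib sum_subtractf flip: sum_distrib_right)
      then show ?thesis using mix[OF cell, of k j] unfolding blk by linarith
    qed
    then have "\<bar>\<Sum>j\<in>{..4} - {i}. s j\<bar> \<le> (\<Sum>j\<in>{..4} - {i}. eps k (blk Q i) (blk Q j))"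
      by (intro order.trans[OF sum_abs] sum_mono)
    then have "\<bar>a k * (\<Sum>j\<in>{..4} - {i}. s j)\<bar> \<le> \<bar>a k\<bar> * (\<Sum>j\<in>{..4} - {i}. eps k (blk Q i) (blk Q j))"
      unfolding abs_mult by (intro mult_left_mono) auto
    then show "a k * (\<Sum>j\<in>{..4} - {i}. \<Sum>q\<in>verts (Q i).
          \<mu> q * (Gk k (Some q) (cfg p j) - Gk k (Some (p i)) (cfg p j)))
        \<le> \<bar>a k\<bar> * (\<Sum>j\<in>{..4} - {i}. eps k (blk Q i) (blk Q j))"
      unfolding s_def by linarith
  qed
  finally have avg: "(\<Sum>q\<in>verts (Q i). \<mu> q * \<Phi> q) \<le> err" .
  \<comment> \<open>Otherwise the average would exceed \<open>err\<close>; strictness comes from a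
    vertex of positive weight.\<close>
  have "\<exists>q \<in> verts (Q i). \<Phi> q \<le> err"
  proof (rule ccontr)
    assume "\<not> ?thesis"
    then have gt: "err < \<Phi> q" if "q \<in> verts (Q i)" for q using that by (meson not_less)
    have "sum \<mu> (verts (Q i)) \<noteq> 0" using one by simp
    then obtain q0 where q0: "q0 \<in> verts (Q i)" "\<mu> q0 \<noteq> 0"
      by (rule sum.not_neutral_contains_not_neutral)
    have "(\<Sum>q\<in>verts (Q i). \<mu> q * err) < (\<Sum>q\<in>verts (Q i). \<mu> q * \<Phi> q)"
    proof (rule sum_strict_mono_ex1)
      show "\<forall>q\<in>verts (Q i). \<mu> q * err \<le> \<mu> q * \<Phi> q"
        by (intro ballI mult_left_mono less_imp_le gt nn)
      have "0 < \<mu> q0" using nn[OF q0(1)] q0(2) by simp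
      then show "\<exists>q\<in>verts (Q i). \<mu> q * err < \<mu> q * \<Phi> q"
        using gt[OF q0(1)] q0(1) by (intro bexI[of _ q0] mult_strict_left_mono)
    qed simp
    moreover have "(\<Sum>q\<in>verts (Q i). \<mu> q * err) = err" using one by (simp flip: sum_distrib_right)
    ultimately show False using avg by simp
  qed
  then obtain q where q: "q \<in> verts (Q i)" "\<Phi> q \<le> err" by blast
  have "\<Phi> q = (\<Sum>k=1..N. a k * energy k (p(i := q))) - (\<Sum>k=1..N. a k * energy k p)"
    unfolding \<Phi>_def by (simp only: right_diff_distrib sum_subtractf)
  then show ?thesis using q unfolding err_def[symmetric] by (intro bexI[of _ q]) linarith
qed

theorem theorem4p9:
  fixes N :: nat and a :: "nat \<Rightarrow> real" and Q :: "nat \<Rightarrow> cell"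
  assumes "good_block Q"
  defines "F \<equiv> (\<lambda>p. \<Sum>k=1..N. a k * energy k p)"
  shows "\<forall>p. (\<forall>i<4. p i \<in> convex hull (verts (Q i))) \<longrightarrow>
           F p \<ge> Min {F q | q. \<forall>i<4. q i \<in> verts (Q i)}
                 - (\<Sum>k=1..N. \<bar>a k\<bar> * ERR k Q)"
proof (intro allI impI)
  fix p assume p: "\<forall>i<4. p i \<in> convex hull (verts (Q i))"
  define err where "err i = (\<Sum>k=1..N. \<bar>a k\<bar> * (\<Sum>j\<in>{..4} - {i}. eps k (blk Q i) (blk Q j)))" for i
  \<comment> \<open>The invariant keeps every point in its hull, which is all that
    \<open>replace_by_vertex\<close> asks of the other points. So \<open>err i\<close> stays the
    same whether or not those have been replaced already.\<close>
  have "\<exists>q. (\<forall>i<4. q i \<in> convex hull (verts (Q i))) \<and> (\<forall>i<m. q i \<in> verts (Q i))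
      \<and> F q \<le> F p + (\<Sum>i<m. err i)" if "m \<le> 4" for m
    using that
  proof (induction m)
    case 0
    then show ?case using p by auto
  next
    case (Suc m)
    then obtain q where q: "\<forall>i<4. q i \<in> convex hull (verts (Q i))" "\<forall>i<m. q i \<in> verts (Q i)"
        "F q \<le> F p + (\<Sum>i<m. err i)" by auto
    obtain v where v: "v \<in> verts (Q m)" "F (q(m := v)) \<le> F q + err m"
      using replace_by_vertex[OF assms(1) q(1), of m a N] Suc.prems unfolding F_def err_def by auto
    have "\<forall>i<4. (q(m := v)) i \<in> convex hull (verts (Q i))" using q(1) v(1) by (auto intro: hull_inc)
    moreover have "\<forall>i<Suc m. (q(m := v)) i \<in> verts (Q i)" using q(2) v(1) by (auto simp: less_Suc_eq)
    moreover have "F (q(m := v)) \<le> F p + (\<Sum>i<Suc m. err i)" using q(3) v(2) by simp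
    ultimately show ?case by blast
  qed
  from this[of 4] obtain q where q: "\<forall>i<4. q i \<in> verts (Q i)" "F q \<le> F p + (\<Sum>i<4. err i)" by auto
  have "(\<Sum>i<4. err i) = (\<Sum>k=1..N. \<bar>a k\<bar> * ERR k Q)"
    unfolding err_def ERR_def by (subst sum.swap) (simp only: sum_distrib_left)
  moreover have "Min {F q | q. \<forall>i<4. q i \<in> verts (Q i)} \<le> F q"
  proof (rule Min_le)
    text \<open>The configurations form an infinite set, but \<open>F\<close> only depends on the entries below 4.\<close>
    have "F r = F (restrict r {..<4})" for r
    proof -
      have "cfg r = cfg (restrict r {..<4})" by (auto simp: cfg_def)
      then show ?thesis unfolding F_def energy_def by simp
    qed
    moreover have "restrict r {..<4} \<in> PiE {..<4} (\<lambda>i. verts (Q i))" if "\<forall>i<4. r i \<in> verts (Q i)" for r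
      using that by auto
    ultimately have "{F q | q. \<forall>i<4. q i \<in> verts (Q i)} \<subseteq> F ` (PiE {..<4} (\<lambda>i. verts (Q i)))"
      by blast
    moreover have "finite (PiE {..<4::nat} (\<lambda>i. verts (Q i)))" by (intro finite_PiE) auto
    ultimately show "finite {F q | q. \<forall>i<4. q i \<in> verts (Q i)}" by (meson finite_imageI finite_subset)
  qed (use q(1) in blast)
  ultimately show "F p \<ge> Min {F q | q. \<forall>i<4. q i \<in> verts (Q i)} - (\<Sum>k=1..N. \<bar>a k\<bar> * ERR k Q)"
    using q(2) by linarith
qed

end
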